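(* Let $I$ be a nearly complete intersection in $R=k[x_1,\dots,x_n]$, let $h$ be a minimal monomial generator of $I$ of degree at least $3$, and let $K$ be the ideal generated by the remaining minimal monomial generators of $I$, so $I=(h)+K$. Then $(h)+K$ is a Betti splitting of $I$: for all $i,j\ge 0$, $$\beta_{ij}(I)=\beta_{ij}((h))+\beta_{ij}(K)+\beta_{i-1,j}((h)\cap K).$$
   Context: $k$ is a field and $R$ is standard graded. A nearly complete intersection is a squarefree monomial ideal $I$ that is not a complete intersection such that for every variable $x$ dividing some generator of $I$, the ideal $I(x=1)$ obtained by substituting $x=1$ in the generators is a complete intersection. $\beta_{ij}(M)$ denotes the graded Betti numbers of a graded $R$-module (ideal) $M$, i.e. the number of degree-$j$ generators of the $i$-th module in a minimal graded free resolution of $M$. *)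

theory Defs
  imports Main "HOL-Library.Poly_Mapping"
begin

text \<open>Monomials are exponent vectors; polynomials are finitely supported
  maps from monomials to coefficients. The variables x_1..x_n of the paper are indexed 0..n-1.\<close>

type_synonym 'k mpoly = "(nat \<Rightarrow>\<^sub>0 nat) \<Rightarrow>\<^sub>0 'k"

definition polyring :: "nat \<Rightarrow> ('k::field) mpoly set" where
  "polyring n = {p. \<forall>m\<in>Poly_Mapping.keys p. Poly_Mapping.keys m \<subseteq> {..<n}}"

definition mdeg :: "(nat \<Rightarrow>\<^sub>0 nat) \<Rightarrow> nat" where
  "mdeg m = (\<Sum>i\<in>Poly_Mapping.keys m. Poly_Mapping.lookup m i)"

definition homogeneous :: "('k::field) mpoly \<Rightarrow> int \<Rightarrow> bool" where
  "homogeneous p e \<longleftrightarrow> (\<forall>m\<in>Poly_Mapping.keys p. int (mdeg m) = e)"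

definition sqf_mono :: "nat set \<Rightarrow> ('k::field) mpoly" where
  "sqf_mono S = Poly_Mapping.single (\<Sum>i\<in>S. Poly_Mapping.single i (1::nat)) 1"

definition gen_ideal :: "nat \<Rightarrow> ('k::field) mpoly set \<Rightarrow> 'k mpoly set" where
  "gen_ideal n S = {\<Sum>s\<in>F. c s * s | F c. finite F \<and> F \<subseteq> S \<and> (\<forall>s\<in>F. c s \<in> polyring n)}"

text \<open>A graded free resolution of a graded module M \<subseteq> R (here: a homogeneous ideal)
  is given by
   - r i : the rank of F_i,
   - d i l : the degree of the l-th basis element of F_i = \<Oplus>_l R(-d i l),
   - A i a b (i \<ge> 1) : the matrix of \<partial>_i : F_i \<rightarrow> F_(i-1) (row a < r (i-1), column b < r i),
   - g l : the image in M of the l-th basis element of F_0 (augmentation F_0 \<rightarrow> M).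
  Elements of F_i are vectors v :: nat \<Rightarrow> poly, supported on {..<r i}.\<close>

type_synonym 'k resolution =
  "(nat \<Rightarrow> nat) \<times> (nat \<Rightarrow> nat \<Rightarrow> int) \<times> (nat \<Rightarrow> nat \<Rightarrow> nat \<Rightarrow> 'k mpoly) \<times> (nat \<Rightarrow> 'k mpoly)"

definition free_mod :: "nat \<Rightarrow> nat \<Rightarrow> (nat \<Rightarrow> ('k::field) mpoly) set" where
  "free_mod n rk = {v. (\<forall>l<rk. v l \<in> polyring n) \<and> (\<forall>l\<ge>rk. v l = 0)}"

definition apply_mat ::
  "nat \<Rightarrow> nat \<Rightarrow> (nat \<Rightarrow> nat \<Rightarrow> ('k::field) mpoly) \<Rightarrow> (nat \<Rightarrow> 'k mpoly) \<Rightarrow> nat \<Rightarrow> 'k mpoly" where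
  "apply_mat rows cols A v = (\<lambda>a. if a < rows then (\<Sum>b<cols. A a b * v b) else 0)"

definition minimal_graded_resolution :: "nat \<Rightarrow> ('k::field) mpoly set \<Rightarrow> 'k resolution \<Rightarrow> bool" where
  "minimal_graded_resolution n M res \<longleftrightarrow>
     (case res of (r, d, A, g) \<Rightarrow>
        \<comment> \<open>augmentation: homogeneous generators of M, surjective\<close>
        (\<forall>l<r 0. g l \<in> M \<and> homogeneous (g l) (d 0 l)) \<and>
        M = {(\<Sum>l<r 0. v l * g l) | v. v \<in> free_mod n (r 0)} \<and>
        \<comment> \<open>differentials are graded (homogeneous entries of the right degree) with entries in R\<close>
        (\<forall>i\<ge>1. \<forall>a<r (i - 1). \<forall>b<r i. A i a b \<in> polyring n \<and>
              homogeneous (A i a b) (d i b - d (i - 1) a)) \<and>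
        \<comment> \<open>exactness at F_0\<close>
        {v \<in> free_mod n (r 0). (\<Sum>l<r 0. v l * g l) = 0}
          = apply_mat (r 0) (r 1) (A 1) ` free_mod n (r 1) \<and>
        \<comment> \<open>exactness at F_i, i \<ge> 1\<close>
        (\<forall>i\<ge>1. {v \<in> free_mod n (r i). apply_mat (r (i - 1)) (r i) (A i) v = (\<lambda>_. 0)}
                 = apply_mat (r i) (r (i + 1)) (A (i + 1)) ` free_mod n (r (i + 1))) \<and>
        \<comment> \<open>minimality: all matrix entries lie in the homogeneous maximal ideal\<close>
        (\<forall>i\<ge>1. \<forall>a<r (i - 1). \<forall>b<r i. Poly_Mapping.lookup (A i a b) 0 = 0))"

definition betti :: "nat \<Rightarrow> ('k::field) mpoly set \<Rightarrow> int \<Rightarrow> int \<Rightarrow> nat" where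
  "betti n M i j =
     (if i < 0 \<or> \<not> (\<exists>res. minimal_graded_resolution n M res) then 0
      else (case (SOME res. minimal_graded_resolution n M res) of (r, d, A, g) \<Rightarrow>
              card {l. l < r (nat i) \<and> d (nat i) l = j}))"

text \<open>A squarefree monomial is identified with its support (a finite set of variables).
  A squarefree monomial ideal is described by its minimal monomial generating set G,
  i.e. a finite antichain of supports.\<close>

definition minimal_sets :: "nat set set \<Rightarrow> nat set set" where
  "minimal_sets S = {A \<in> S. \<forall>B\<in>S. B \<subseteq> A \<longrightarrow> B = A}"

definition is_min_gen_set :: "nat \<Rightarrow> nat set set \<Rightarrow> bool" where
  "is_min_gen_set n G \<longleftrightarrow> finite G \<and> (\<forall>g\<in>G. g \<subseteq> {..<n}) \<and> minimal_sets G = G"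

text \<open>A monomial ideal is a complete intersection iff its minimal generators have pairwise
  disjoint supports (i.e. are pairwise coprime).\<close>
definition complete_intersection :: "nat set set \<Rightarrow> bool" where
  "complete_intersection G \<longleftrightarrow> (\<forall>g\<in>G. \<forall>g'\<in>G. g \<noteq> g' \<longrightarrow> g \<inter> g' = {})"

definition subst_one :: "nat set set \<Rightarrow> nat \<Rightarrow> nat set set" where
  "subst_one G x = minimal_sets ((\<lambda>g. g - {x}) ` G)"

definition nearly_complete_intersection :: "nat set set \<Rightarrow> bool" where
  "nearly_complete_intersection G \<longleftrightarrow>
     \<not> complete_intersection G \<and> (\<forall>x\<in>\<Union>G. complete_intersection (subst_one G x))"

end

theory Submission
  imports Defs "HOL.Vector_Spaces" "HOL-Library.Function_Algebras"
begin

text \<open>For \<open>z \<in> h\<close> the localisations of a nearly complete intersection give the exchange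
  property that every other generator \<open>g\<close> admits a generator \<open>g' \<noteq> h\<close> with
  \<open>g' \<subseteq> insert z (g - h)\<close>. Hence \<open>x J \<subseteq> K\<close> for \<open>J = K : h\<close> and \<open>x\<close> the variable with index \<open>z\<close>.
  Writing \<open>h = u x\<close>, the inclusion \<open>H \<inter> K = u x J \<subseteq> K\<close> is, up to the isomorphism \<open>u x J \<cong> x J\<close>,
  multiplication by \<open>u\<close> followed by an inclusion. It therefore lifts to a chain map divisible by \<open>u\<close>
  from the minimal resolution of \<open>J\<close> to that of \<open>K\<close>, and the mapping cone of that lift is a minimal
  resolution of \<open>I\<close>.

  Minimal resolutions of squarefree monomial ideals exist because all their syzygy modules are
  determined by finitely many finite-dimensional spaces, indexed by the squarefree multidegrees;
  Betti numbers do not depend on the resolution, as homotopic maps of minimal complexes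
  agree modulo the maximal ideal.\<close>

section \<open>Polynomials\<close>

text \<open>The obstacle is minimality of the cone. An arbitrary lift of multiplication by
  \<open>h\<close> from the resolution of \<open>J\<close> to that of \<open>K\<close> may have unit
  entries, and each of them would cancel a pair of basis elements. Lifting \<open>x\<close> alone
  and multiplying the lift by \<open>u\<close> afterwards excludes units, since \<open>u\<close> is
  a monomial of positive degree; one variable of \<open>h\<close> with the exchange property is
  enough for this. All resolutions carry the ring in position 0, so they resolve R/J and R/K. The
  cone is formed on these extended complexes, that of \<open>J\<close> twisted by the degree of
  \<open>h\<close>. Position 0 of the latter is then a free module of rank one resolving
  \<open>H\<close>, and its later positions resolve \<open>H \<inter> K\<close>, one homological
  step up; this is where the three summands come from. \<open>betti\<close> chooses some minimal
  resolution and is 0 if there is none. Reading it off the cone therefore takes both existence and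
  independence of the choice.\<close>

lemma polyring_0 [simp]: "0 \<in> polyring n"
  by (simp add: polyring_def)

lemma polyring_1 [simp]: "1 \<in> polyring n"
  by (simp add: polyring_def)

lemma polyring_add [simp]: "p \<in> polyring n \<Longrightarrow> q \<in> polyring n \<Longrightarrow> p + q \<in> polyring n"
  unfolding polyring_def using Poly_Mapping.keys_add[of p q] by blast

lemma polyring_uminus [simp]: "p \<in> polyring n \<Longrightarrow> - p \<in> polyring n"
  by (auto simp: polyring_def in_keys_iff)

lemma polyring_diff [simp]: "p \<in> polyring n \<Longrightarrow> q \<in> polyring n \<Longrightarrow> p - q \<in> polyring n"
  using polyring_add[of p n "- q"] by simp

lemma keys_plus_nat:
  fixes s t :: "nat \<Rightarrow>\<^sub>0 nat"
  shows "Poly_Mapping.keys (s + t) = Poly_Mapping.keys s \<union> Poly_Mapping.keys t"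
  by (auto simp: in_keys_iff lookup_add)

lemma polyring_mult [simp]:
  assumes "p \<in> polyring n" "q \<in> polyring n"
  shows "p * q \<in> polyring n"
  unfolding polyring_def
proof safe
  fix m x assume "m \<in> Poly_Mapping.keys (p * q)" "x \<in> Poly_Mapping.keys m"
  with keys_mult[of p q] obtain a b where "m = a + b" "a \<in> Poly_Mapping.keys p" "b \<in> Poly_Mapping.keys q"
    by blast
  with assms \<open>x \<in> Poly_Mapping.keys m\<close> show "x < n"
    by (auto simp: polyring_def keys_plus_nat)
qed

lemma polyring_sum [simp]: "(\<And>a. a \<in> A \<Longrightarrow> f a \<in> polyring n) \<Longrightarrow> sum f A \<in> polyring n"
  by (induction A rule: infinite_finite_induct) auto

lemma polyring_single [simp]: "Poly_Mapping.keys m \<subseteq> {..<n} \<Longrightarrow> Poly_Mapping.single m c \<in> polyring n"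
  by (auto simp: polyring_def)

lemma mdeg_alt: "finite A \<Longrightarrow> Poly_Mapping.keys m \<subseteq> A \<Longrightarrow> mdeg m = (\<Sum>i\<in>A. Poly_Mapping.lookup m i)"
  unfolding mdeg_def by (rule sum.mono_neutral_left) (auto simp: in_keys_iff)

lemma mdeg_add: "mdeg (s + t) = mdeg s + mdeg t"
  using mdeg_alt[of "Poly_Mapping.keys s \<union> Poly_Mapping.keys t" s]
    mdeg_alt[of "Poly_Mapping.keys s \<union> Poly_Mapping.keys t" t]
  by (subst mdeg_alt[of "Poly_Mapping.keys s \<union> Poly_Mapping.keys t"])
    (auto simp: keys_plus_nat lookup_add sum.distrib)

lemma mdeg_0 [simp]: "mdeg 0 = 0"
  by (simp add: mdeg_def)

lemma homogeneous_0 [simp]: "homogeneous 0 e"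
  by (simp add: homogeneous_def)

lemma homogeneous_1 [simp]: "homogeneous 1 0"
  by (simp add: homogeneous_def)

lemma homogeneous_single: "homogeneous (Poly_Mapping.single m c) (int (mdeg m))"
  by (simp add: homogeneous_def)

lemma homogeneous_add: "homogeneous p e \<Longrightarrow> homogeneous q e \<Longrightarrow> homogeneous (p + q) e"
  unfolding homogeneous_def using Poly_Mapping.keys_add[of p q] by blast

lemma homogeneous_uminus: "homogeneous p e \<Longrightarrow> homogeneous (- p) e"
  by (auto simp: homogeneous_def in_keys_iff)

lemma homogeneous_sum: "(\<And>a. a \<in> A \<Longrightarrow> homogeneous (f a) e) \<Longrightarrow> homogeneous (sum f A) e"
  by (induction A rule: infinite_finite_induct) (auto intro: homogeneous_add)

lemma homogeneous_mult:
  assumes "homogeneous p e" "homogeneous q e'"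
  shows "homogeneous (p * q) (e + e')"
  unfolding homogeneous_def
proof
  fix m assume "m \<in> Poly_Mapping.keys (p * q)"
  with keys_mult[of p q] obtain a b where "m = a + b" "a \<in> Poly_Mapping.keys p" "b \<in> Poly_Mapping.keys q"
    by blast
  with assms show "int (mdeg m) = e + e'"
    by (auto simp: homogeneous_def mdeg_add)
qed

text \<open>\<open>lookup p 0\<close> is the constant term, that is, \<open>p\<close> modulo the
  homogeneous maximal ideal. That a nonzero one forces degree 0 is what later sorts Betti numbers by
  \<open>j\<close>.\<close>

lemma lookup_0_homogeneous: "homogeneous p e \<Longrightarrow> Poly_Mapping.lookup p 0 \<noteq> 0 \<Longrightarrow> e = 0"
  unfolding homogeneous_def by (metis in_keys_iff mdeg_0 of_nat_0)

lemma poly_sum_single: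
  assumes "finite A" "Poly_Mapping.keys p \<subseteq> A"
  shows "p = (\<Sum>m\<in>A. Poly_Mapping.single m (Poly_Mapping.lookup p m))"
  using assms by (intro poly_mapping_eqI) (auto simp: lookup_sum lookup_single when_def in_keys_iff)

lemma lookup_single_mult:
  fixes m :: "nat \<Rightarrow>\<^sub>0 nat" and p :: "('k::field) mpoly"
  shows "Poly_Mapping.lookup (Poly_Mapping.single s c * p) (s + m) = c * Poly_Mapping.lookup p m"
proof -
  have "Poly_Mapping.single s c * p
    = (\<Sum>m\<in>Poly_Mapping.keys p. Poly_Mapping.single (s + m) (c * Poly_Mapping.lookup p m))"
    by (subst poly_sum_single[of "Poly_Mapping.keys p" p]) (auto simp: sum_distrib_left mult_single)
  then show ?thesis
    by (auto simp: lookup_sum lookup_single when_def in_keys_iff)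
qed

lemma lookup_single_mult_not:
  fixes m :: "nat \<Rightarrow>\<^sub>0 nat" and p :: "('k::field) mpoly"
  assumes "\<And>t. m \<noteq> s + t"
  shows "Poly_Mapping.lookup (Poly_Mapping.single s c * p) m = 0"
proof (rule ccontr)
  assume "\<not> ?thesis"
  then have "m \<in> Poly_Mapping.keys (Poly_Mapping.single s c * p)" by (simp add: in_keys_iff)
  with keys_mult[of "Poly_Mapping.single s c" p] assms show False
    by (auto split: if_splits)
qed

text \<open>The exponent 0 has only the trivial decomposition as a sum, so taking constant terms is
  a ring homomorphism to the field. Minimality is always computed through it.\<close>

lemma lookup_0_mult:
  fixes p q :: "('k::field) mpoly"
  shows "Poly_Mapping.lookup (p * q) 0 = Poly_Mapping.lookup p 0 * Poly_Mapping.lookup q 0"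
proof -
  have *: "Poly_Mapping.lookup (Poly_Mapping.single s c * q) 0
      = (if s = 0 then c * Poly_Mapping.lookup q 0 else 0)" for s c
  proof (cases "s = 0")
    case True
    with lookup_single_mult[of 0 c q 0] show ?thesis by simp
  next
    case False
    then have "0 \<noteq> s + t" for t
      by (metis keys_plus_nat keys_zero Un_empty keys_eq_empty)
    then show ?thesis using lookup_single_mult_not[of 0 s c q] False by simp
  qed
  have "p * q = (\<Sum>s\<in>Poly_Mapping.keys p. Poly_Mapping.single s (Poly_Mapping.lookup p s) * q)"
    by (subst poly_sum_single[of "Poly_Mapping.keys p" p]) (auto simp: sum_distrib_right)
  then show ?thesis
    by (auto simp: lookup_sum * in_keys_iff)
qed

section \<open>Homogeneous components\<close>

definition hcomp :: "int \<Rightarrow> ('k::field) mpoly \<Rightarrow> 'k mpoly" where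
  "hcomp e p = (\<Sum>m | m \<in> Poly_Mapping.keys p \<and> int (mdeg m) = e. Poly_Mapping.single m (Poly_Mapping.lookup p m))"

lemma lookup_hcomp: "Poly_Mapping.lookup (hcomp e p) m = (if int (mdeg m) = e then Poly_Mapping.lookup p m else 0)"
  by (auto simp: hcomp_def lookup_sum lookup_single when_def in_keys_iff)

lemma homogeneous_hcomp [simp]: "homogeneous (hcomp e p) e"
  by (auto simp: homogeneous_def in_keys_iff lookup_hcomp split: if_splits)

lemma polyring_hcomp [simp]: "p \<in> polyring n \<Longrightarrow> hcomp e p \<in> polyring n"
  by (auto simp: polyring_def in_keys_iff lookup_hcomp split: if_splits)

lemma hcomp_add: "hcomp e (p + q) = hcomp e p + hcomp e q"
  by (rule poly_mapping_eqI) (auto simp: lookup_hcomp lookup_add)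

lemma hcomp_0 [simp]: "hcomp e 0 = 0"
  by (rule poly_mapping_eqI) (auto simp: lookup_hcomp)

lemma hcomp_sum: "hcomp e (sum f A) = (\<Sum>a\<in>A. hcomp e (f a))"
  by (induction A rule: infinite_finite_induct) (auto simp: hcomp_add)

lemma hcomp_homogeneous: "homogeneous p e \<Longrightarrow> hcomp e p = p"
  by (rule poly_mapping_eqI) (auto simp: lookup_hcomp homogeneous_def in_keys_iff)

lemma hcomp_eq_0: "homogeneous p e' \<Longrightarrow> e \<noteq> e' \<Longrightarrow> hcomp e p = 0"
  by (rule poly_mapping_eqI) (auto simp: lookup_hcomp homogeneous_def in_keys_iff)

text \<open>A homogeneous factor shifts all degrees by \<open>d\<close>, so the component can be
  taken on the other factor; by linearity it suffices to look at single terms.\<close>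

lemma hcomp_mult:
  fixes p q :: "('k::field) mpoly"
  assumes "homogeneous q d"
  shows "hcomp e (p * q) = hcomp (e - d) p * q"
proof -
  have *: "hcomp e (Poly_Mapping.single s c * q) = hcomp (e - d) (Poly_Mapping.single s c) * q" for s c
  proof (cases "int (mdeg s) = e - d")
    case True
    then have "homogeneous (Poly_Mapping.single s c * q) e"
      using homogeneous_mult[OF homogeneous_single assms, of s c] by simp
    moreover have "homogeneous (Poly_Mapping.single s c) (e - d)"
      using homogeneous_single[of s c] True by simp
    ultimately show ?thesis by (simp add: hcomp_homogeneous)
  next
    case False
    then show ?thesis
      using hcomp_eq_0[OF homogeneous_mult[OF homogeneous_single assms, of s c], of e]
        hcomp_eq_0[OF homogeneous_single[of s c], of "e - d"] by simp
  qed
  have p: "p = (\<Sum>s\<in>Poly_Mapping.keys p. Poly_Mapping.single s (Poly_Mapping.lookup p s))"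
    by (rule poly_sum_single) auto
  show ?thesis
    by (subst (1 2) p) (simp add: sum_distrib_right hcomp_sum *)
qed

section \<open>Free modules and graded complexes\<close>

text \<open>Matrices are stored by columns, \<open>C b\<close> being the image of the
  \<open>b\<close>-th basis element. Lifting and composing then work one column at a time, and the
  row bound is carried by the columns lying in \<open>free_mod\<close>.\<close>

definition lin :: "nat \<Rightarrow> (nat \<Rightarrow> nat \<Rightarrow> ('k::field) mpoly) \<Rightarrow> (nat \<Rightarrow> 'k mpoly) \<Rightarrow> nat \<Rightarrow> 'k mpoly" where
  "lin r C v = (\<lambda>a. \<Sum>b<r. v b * C b a)"

definition unit_vec :: "nat \<Rightarrow> nat \<Rightarrow> ('k::field) mpoly" where
  "unit_vec b = (\<lambda>a. if a = b then 1 else 0)"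

lemma free_mod_0 [simp]: "(\<lambda>_. 0) \<in> free_mod n r"
  by (simp add: free_mod_def)

lemma free_mod_add [simp]: "v \<in> free_mod n r \<Longrightarrow> w \<in> free_mod n r \<Longrightarrow> (\<lambda>a. v a + w a) \<in> free_mod n r"
  by (simp add: free_mod_def)

lemma free_mod_diff [simp]: "v \<in> free_mod n r \<Longrightarrow> w \<in> free_mod n r \<Longrightarrow> (\<lambda>a. v a - w a) \<in> free_mod n r"
  by (simp add: free_mod_def)

lemma free_mod_uminus [simp]: "v \<in> free_mod n r \<Longrightarrow> (\<lambda>a. - v a) \<in> free_mod n r"
  by (simp add: free_mod_def)

lemma free_mod_smult [simp]: "p \<in> polyring n \<Longrightarrow> v \<in> free_mod n r \<Longrightarrow> (\<lambda>a. p * v a) \<in> free_mod n r"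
  by (simp add: free_mod_def)

lemma free_mod_unit_vec [simp]: "b < r \<Longrightarrow> unit_vec b \<in> free_mod n r"
  by (auto simp: free_mod_def unit_vec_def)

lemma free_mod_polyring: "v \<in> free_mod n r \<Longrightarrow> v a \<in> polyring n"
  by (cases "a < r") (auto simp: free_mod_def)

lemma free_mod_lin [simp]:
  assumes "v \<in> free_mod n r" "\<And>b. b < r \<Longrightarrow> C b \<in> free_mod n r'"
  shows "lin r C v \<in> free_mod n r'"
  using assms by (auto simp: free_mod_def lin_def intro!: polyring_sum polyring_mult)

lemma lin_0 [simp]: "lin r C (\<lambda>_. 0) = (\<lambda>_. 0)"
  by (simp add: lin_def)

lemma lin_add: "lin r C (\<lambda>a. v a + w a) = (\<lambda>a. lin r C v a + lin r C w a)"
  by (simp add: lin_def distrib_right sum.distrib)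

lemma lin_diff: "lin r C (\<lambda>a. v a - w a) = (\<lambda>a. lin r C v a - lin r C w a)"
  by (simp add: lin_def left_diff_distrib sum_subtractf)

lemma lin_uminus: "lin r C (\<lambda>a. - v a) = (\<lambda>a. - lin r C v a)"
  by (simp add: lin_def sum_negf)

lemma lin_smult: "lin r C (\<lambda>a. p * v a) = (\<lambda>a. p * lin r C v a)"
  by (simp add: lin_def sum_distrib_left mult.assoc)

lemma lin_diff_col: "lin r (\<lambda>b a. C b a - C' b a) v = (\<lambda>a. lin r C v a - lin r C' v a)"
  by (simp add: lin_def right_diff_distrib sum_subtractf)

lemma lin_smult_col: "lin r (\<lambda>b a. p * C b a) v = (\<lambda>a. p * lin r C v a)"
  by (simp add: lin_def sum_distrib_left mult.left_commute)

lemma lin_cong: "(\<And>b. b < r \<Longrightarrow> C b = C' b) \<Longrightarrow> lin r C v = lin r C' v"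
  by (simp add: lin_def)

lemma lin_unit_vec: "b < r \<Longrightarrow> lin r C (unit_vec b) = C b"
proof -
  assume "b < r"
  have "(\<Sum>c<r. unit_vec b c * C c a) = (\<Sum>c<r. if c = b then C c a else 0)" for a
    by (rule sum.cong) (auto simp: unit_vec_def)
  with \<open>b < r\<close> show ?thesis by (simp add: lin_def)
qed

lemma lin_id: "v \<in> free_mod n r \<Longrightarrow> lin r unit_vec v = v"
proof
  fix a assume v: "v \<in> free_mod n r"
  have "(\<Sum>c<r. v c * unit_vec c a) = (\<Sum>c<r. if c = a then v c else 0)"
    by (rule sum.cong) (auto simp: unit_vec_def)
  with v show "lin r unit_vec v a = v a" by (simp add: lin_def free_mod_def)
qed

lemma lin_comp: "lin r' C' (lin r C v) = lin r (\<lambda>b. lin r' C' (C b)) v"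
proof
  fix a
  have "(\<Sum>c<r'. (\<Sum>b<r. v b * C b c) * C' c a) = (\<Sum>c<r'. \<Sum>b<r. v b * (C b c * C' c a))"
    by (simp add: sum_distrib_right mult.assoc)
  also have "\<dots> = (\<Sum>b<r. \<Sum>c<r'. v b * (C b c * C' c a))"
    by (rule sum.swap)
  finally show "lin r' C' (lin r C v) a = lin r (\<lambda>b. lin r' C' (C b)) v a"
    by (simp add: lin_def sum_distrib_left)
qed

text \<open>Homogeneous elements of degree \<open>e\<close> in the sum of the R(-d a). A map whose
  columns are homogeneous of the degrees of their basis elements is graded of degree 0.\<close>

definition hvec :: "nat \<Rightarrow> nat \<Rightarrow> (nat \<Rightarrow> int) \<Rightarrow> int \<Rightarrow> (nat \<Rightarrow> ('k::field) mpoly) \<Rightarrow> bool" where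
  "hvec n r d e v \<longleftrightarrow> v \<in> free_mod n r \<and> (\<forall>a<r. homogeneous (v a) (e - d a))"

lemma hvec_free_mod: "hvec n r d e v \<Longrightarrow> v \<in> free_mod n r"
  by (simp add: hvec_def)

lemma hvec_lin:
  assumes v: "hvec n r d e v" and C: "\<And>b. b < r \<Longrightarrow> hvec n r' d' (d b) (C b)"
  shows "hvec n r' d' e (lin r C v)"
  unfolding hvec_def
proof (intro conjI allI impI)
  show "lin r C v \<in> free_mod n r'"
    using v C by (auto simp: hvec_def)
  fix a assume "a < r'"
  then have "homogeneous (v b * C b a) ((e - d b) + (d b - d' a))" if "b < r" for b
    using v C that by (intro homogeneous_mult) (auto simp: hvec_def)
  then show "homogeneous (lin r C v a) (e - d' a)"
    unfolding lin_def by (intro homogeneous_sum) auto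
qed

text \<open>Take homogeneous components of any preimage.\<close>
lemma hvec_preimage:
  assumes C: "\<And>b. b < r \<Longrightarrow> hvec n r' d' (d b) (C b)"
    and v: "hvec n r' d' e v" and "v \<in> lin r C ` free_mod n r"
  shows "\<exists>w. hvec n r d e w \<and> lin r C w = v"
proof -
  obtain w where w: "w \<in> free_mod n r" "v = lin r C w" using assms by auto
  define w' where "w' = (\<lambda>b. hcomp (e - d b) (w b))"
  have "hvec n r d e w'"
    using w by (auto simp: hvec_def w'_def free_mod_def)
  moreover have "lin r C w' = v"
  proof
    fix a
    show "lin r C w' a = v a"
    proof (cases "a < r'")
      case True
      then have "v a = hcomp (e - d' a) (v a)"
        using v by (simp add: hvec_def hcomp_homogeneous)
      also have "\<dots> = (\<Sum>b<r. hcomp (e - d' a) (w b * C b a))"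
        by (simp add: w lin_def hcomp_sum)
      also have "\<dots> = (\<Sum>b<r. w' b * C b a)"
      proof (rule sum.cong[OF refl])
        fix b assume "b \<in> {..<r}"
        then have "homogeneous (C b a) (d b - d' a)" using C True by (auto simp: hvec_def)
        then show "hcomp (e - d' a) (w b * C b a) = w' b * C b a"
          by (simp add: hcomp_mult w'_def)
      qed
      finally show ?thesis by (simp add: lin_def)
    next
      case False
      then have "C b a = 0" if "b < r" for b using C[OF that] by (auto simp: hvec_def free_mod_def)
      moreover have "v a = 0" using False v by (auto simp: hvec_def free_mod_def)
      ultimately show ?thesis by (simp add: lin_def)
    qed
  qed
  ultimately show ?thesis by blast
qed

text \<open>\<open>C i b\<close> is the image in the \<open>i\<close>-th free module of the \<open>b\<close>-th basis element of the next one.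
  A resolution of an ideal appears here extended by the ring itself in position 0, so that the
  augmentation is the differential \<open>C 0\<close>; it is exempt from minimality.\<close>
definition min_res :: "nat \<Rightarrow> (nat \<Rightarrow> nat) \<Rightarrow> (nat \<Rightarrow> nat \<Rightarrow> int) \<Rightarrow> (nat \<Rightarrow> nat \<Rightarrow> nat \<Rightarrow> ('k::field) mpoly) \<Rightarrow> bool" where
  "min_res n R D C \<longleftrightarrow>
    (\<forall>i. \<forall>b<R (Suc i). hvec n (R i) (D i) (D (Suc i) b) (C i b)) \<and>
    (\<forall>i. {v \<in> free_mod n (R (Suc i)). lin (R (Suc i)) (C i) v = (\<lambda>_. 0)}
       = lin (R (Suc (Suc i))) (C (Suc i)) ` free_mod n (R (Suc (Suc i)))) \<and>
    (\<forall>i a. \<forall>b<R (Suc (Suc i)). Poly_Mapping.lookup (C (Suc i) b a) 0 = 0)"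

lemma min_res_hvec: "min_res n R D C \<Longrightarrow> b < R (Suc i) \<Longrightarrow> hvec n (R i) (D i) (D (Suc i) b) (C i b)"
  by (simp add: min_res_def)

lemma min_res_free: "min_res n R D C \<Longrightarrow> b < R (Suc i) \<Longrightarrow> C i b \<in> free_mod n (R i)"
  using min_res_hvec hvec_free_mod by blast

lemma min_res_exact:
  "min_res n R D C \<Longrightarrow> v \<in> free_mod n (R (Suc i)) \<Longrightarrow> lin (R (Suc i)) (C i) v = (\<lambda>_. 0)
    \<Longrightarrow> v \<in> lin (R (Suc (Suc i))) (C (Suc i)) ` free_mod n (R (Suc (Suc i)))"
  unfolding min_res_def by blast

lemma min_res_lin_lin:
  assumes "min_res n R D C" "v \<in> free_mod n (R (Suc (Suc i)))"
  shows "lin (R (Suc i)) (C i) (lin (R (Suc (Suc i))) (C (Suc i)) v) = (\<lambda>_. 0)"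
  using assms unfolding min_res_def by blast

lemma min_res_complex:
  assumes "min_res n R D C" "b < R (Suc (Suc i))"
  shows "lin (R (Suc i)) (C i) (C (Suc i) b) = (\<lambda>_. 0)"
  using min_res_lin_lin[OF assms(1), of "unit_vec b" i] assms(2) by (simp add: lin_unit_vec)

lemma min_res_lookup: "min_res n R D C \<Longrightarrow> b < R (Suc (Suc i)) \<Longrightarrow> Poly_Mapping.lookup (C (Suc i) b a) 0 = 0"
  by (simp add: min_res_def)

text \<open>Only differences of degrees enter. Such a twist turns multiplication by a form of degree
  \<open>e\<close> into a map of degree 0.\<close>

lemma min_res_shift: "min_res n R (\<lambda>i b. D i b + e) C = min_res n R D C"
  by (simp add: min_res_def hvec_def)

text \<open>Graded projectivity of free modules: a map out of one lifts as soon as the images of its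
  basis elements do.\<close>

lemma lift_columns:
  assumes "\<And>b. b < r \<Longrightarrow> hvec n r' d' (d b) (C b)"
    and "\<And>b. b < s \<Longrightarrow> hvec n r' d' (e b) (y b)"
    and "\<And>b. b < s \<Longrightarrow> y b \<in> lin r C ` free_mod n r"
  shows "\<exists>w. \<forall>b<s. hvec n r d (e b) (w b) \<and> lin r C (w b) = y b"
proof -
  have "\<forall>b\<in>{..<s}. \<exists>w. hvec n r d (e b) w \<and> lin r C w = y b"
  proof
    fix b assume "b \<in> {..<s}"
    then show "\<exists>w. hvec n r d (e b) w \<and> lin r C w = y b"
      using assms(2,3)[of b] by (intro hvec_preimage[OF assms(1)]) auto
  qed
  from bchoice[OF this] show ?thesis by auto
qed

section \<open>Graded chain maps and the comparison theorem\<close>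

definition chain_map :: "nat \<Rightarrow> (nat \<Rightarrow> nat) \<Rightarrow> (nat \<Rightarrow> nat \<Rightarrow> int) \<Rightarrow> (nat \<Rightarrow> nat \<Rightarrow> nat \<Rightarrow> ('k::field) mpoly)
    \<Rightarrow> (nat \<Rightarrow> nat) \<Rightarrow> (nat \<Rightarrow> nat \<Rightarrow> int) \<Rightarrow> (nat \<Rightarrow> nat \<Rightarrow> nat \<Rightarrow> 'k mpoly)
    \<Rightarrow> (nat \<Rightarrow> nat \<Rightarrow> nat \<Rightarrow> 'k mpoly) \<Rightarrow> bool" where
  "chain_map n R D C R' D' C' f \<longleftrightarrow>
    (\<forall>i. \<forall>b<R i. hvec n (R' i) (D' i) (D i b) (f i b)) \<and>
    (\<forall>i. \<forall>b<R (Suc i). lin (R i) (f i) (C i b) = lin (R' (Suc i)) (C' i) (f (Suc i) b))"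

lemma chain_map_lin:
  assumes "chain_map n R D C R' D' C' f"
  shows "lin (R i) (f i) (lin (R (Suc i)) (C i) v) = lin (R' (Suc i)) (C' i) (lin (R (Suc i)) (f (Suc i)) v)"
  using assms unfolding lin_comp chain_map_def by (intro lin_cong) auto

lemma chain_map_free: "chain_map n R D C R' D' C' f \<Longrightarrow> b < R i \<Longrightarrow> f i b \<in> free_mod n (R' i)"
  unfolding chain_map_def hvec_def by blast

text \<open>Each lift sends boundaries to cycles, and exactness of the target supplies the next
  lift. At the bottom the image is an ideal rather than a kernel, so the lifting starts from
  \<open>im\<close>.\<close>

lemma comparison:
  fixes C C' :: "nat \<Rightarrow> nat \<Rightarrow> nat \<Rightarrow> ('k::field) mpoly"
  assumes X: "min_res n R D C" and X': "min_res n R' D' C'"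
    and f0: "\<And>b. b < R 0 \<Longrightarrow> hvec n (R' 0) (D' 0) (D 0 b) (f0 b)"
    and im: "\<And>b. b < R (Suc 0) \<Longrightarrow> lin (R 0) f0 (C 0 b) \<in> lin (R' (Suc 0)) (C' 0) ` free_mod n (R' (Suc 0))"
  obtains f where "f 0 = f0" "chain_map n R D C R' D' C' f"
proof -
  \<comment> \<open>Each stage of the recursion must guarantee the next one: the middle clause says
    that the columns to be lifted are liftable, the last one pins the start to
    \<open>f0\<close>.\<close>
  let ?P = "\<lambda>i f. (\<forall>b<R i. hvec n (R' i) (D' i) (D i b) (f b)) \<and>
     (\<forall>b<R (Suc i). lin (R i) f (C i b) \<in> lin (R' (Suc i)) (C' i) ` free_mod n (R' (Suc i))) \<and> (i = 0 \<longrightarrow> f = f0)"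
  let ?Q = "\<lambda>i f f'. \<forall>b<R (Suc i). lin (R i) f (C i b) = lin (R' (Suc i)) (C' i) (f' b)"
  have "\<exists>f. \<forall>i. ?P i (f i) \<and> ?Q i (f i) (f (Suc i))"
  proof (rule dependent_nat_choice)
    show "\<exists>f. ?P 0 f" using f0 im by blast
    fix f i assume P: "?P i f"
    have "\<exists>w. \<forall>b<R (Suc i). hvec n (R' (Suc i)) (D' (Suc i)) (D (Suc i) b) (w b)
        \<and> lin (R' (Suc i)) (C' i) (w b) = lin (R i) f (C i b)"
    proof (rule lift_columns)
      show "hvec n (R' i) (D' i) (D' (Suc i) b) (C' i b)" if "b < R' (Suc i)" for b
        using min_res_hvec[OF X'] that .
      show "hvec n (R' i) (D' i) (D (Suc i) b) (lin (R i) f (C i b))" if "b < R (Suc i)" for b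
        using min_res_hvec[OF X that] P by (auto intro: hvec_lin)
      show "lin (R i) f (C i b) \<in> lin (R' (Suc i)) (C' i) ` free_mod n (R' (Suc i))" if "b < R (Suc i)" for b
        using P that by blast
    qed
    then obtain w where w: "\<And>b. b < R (Suc i) \<Longrightarrow> hvec n (R' (Suc i)) (D' (Suc i)) (D (Suc i) b) (w b)"
      "\<And>b. b < R (Suc i) \<Longrightarrow> lin (R' (Suc i)) (C' i) (w b) = lin (R i) f (C i b)" by blast
    have "lin (R (Suc i)) w (C (Suc i) b) \<in> lin (R' (Suc (Suc i))) (C' (Suc i)) ` free_mod n (R' (Suc (Suc i)))"
      if b: "b < R (Suc (Suc i))" for b
    proof (rule min_res_exact[OF X'])
      show "lin (R (Suc i)) w (C (Suc i) b) \<in> free_mod n (R' (Suc i))"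
        using min_res_free[OF X b] hvec_free_mod[OF w(1)] by (rule free_mod_lin)
      have "lin (R' (Suc i)) (C' i) (lin (R (Suc i)) w (C (Suc i) b))
          = lin (R (Suc i)) (\<lambda>b. lin (R i) f (C i b)) (C (Suc i) b)"
        unfolding lin_comp using w(2) by (intro lin_cong) auto
      also have "\<dots> = lin (R i) f (lin (R (Suc i)) (C i) (C (Suc i) b))"
        by (simp add: lin_comp)
      finally show "lin (R' (Suc i)) (C' i) (lin (R (Suc i)) w (C (Suc i) b)) = (\<lambda>_. 0)"
        by (simp add: min_res_complex[OF X b])
    qed
    then show "\<exists>f'. ?P (Suc i) f' \<and> ?Q i f f'"
      using w by (intro exI[of _ w]) simp
  qed
  then show ?thesis using that unfolding chain_map_def by blast
qed

section \<open>Uniqueness of Betti numbers\<close>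

text \<open>The usual null-homotopy of \<open>t - id\<close>. As \<open>t\<close> is the identity in
  position 0, it can start with \<open>s 0 = 0\<close>, which matters where the differential
  \<open>C 0\<close> has no minimality to offer.\<close>

lemma homotopy:
  fixes C :: "nat \<Rightarrow> nat \<Rightarrow> nat \<Rightarrow> ('k::field) mpoly"
  assumes X: "min_res n R D C" and t: "chain_map n R D C R D C t"
    and t0: "\<And>b. b < R 0 \<Longrightarrow> t 0 b = unit_vec b"
  obtains s where "\<And>i b. b < R i \<Longrightarrow> s i b \<in> free_mod n (R (Suc i))" "\<And>b. s 0 b = (\<lambda>_. 0)"
    "\<And>i b. b < R (Suc i) \<Longrightarrow> lin (R (Suc (Suc i))) (C (Suc i)) (s (Suc i) b)
       = (\<lambda>a. t (Suc i) b a - unit_vec b a - lin (R i) (s i) (C i b) a)"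
proof -
  \<comment> \<open>The last clause says \<open>d s = t - id\<close> on boundaries. It makes the
    next \<open>t - id - s d\<close> a cycle, and it reproduces itself because \<open>s d\<close>
    vanishes on boundaries.\<close>
  let ?P = "\<lambda>i s. (\<forall>b<R i. s b \<in> free_mod n (R (Suc i))) \<and> (i = 0 \<longrightarrow> s = (\<lambda>_ _. 0)) \<and>
     (\<forall>v\<in>free_mod n (R (Suc i)). lin (R (Suc i)) (C i) (lin (R i) s (lin (R (Suc i)) (C i) v))
        = (\<lambda>a. lin (R i) (t i) (lin (R (Suc i)) (C i) v) a - lin (R (Suc i)) (C i) v a))"
  let ?Q = "\<lambda>i s s'. \<forall>b<R (Suc i). lin (R (Suc (Suc i))) (C (Suc i)) (s' b)
       = (\<lambda>a. t (Suc i) b a - unit_vec b a - lin (R i) s (C i b) a)"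
  have "\<exists>s. \<forall>i. ?P i (s i) \<and> ?Q i (s i) (s (Suc i))"
  proof (rule dependent_nat_choice)
    have "lin (R 0) (t 0) w = w" if "w \<in> free_mod n (R 0)" for w
      using lin_cong[of "R 0" "t 0" unit_vec w] t0 lin_id[OF that] by simp
    moreover have "lin (R (Suc 0)) (C 0) v \<in> free_mod n (R 0)" if "v \<in> free_mod n (R (Suc 0))" for v
      using that min_res_free[OF X] by auto
    moreover have "lin (R 0) (\<lambda>_ _. 0) w = (\<lambda>_. 0)" for w :: "nat \<Rightarrow> 'k mpoly"
      by (simp add: lin_def)
    ultimately show "\<exists>s. ?P 0 s" by (intro exI[of _ "\<lambda>_ _. 0"]) simp
  next
    fix s i assume P: "?P i s"
    define y where "y = (\<lambda>b a. t (Suc i) b a - unit_vec b a - lin (R i) s (C i b) a)"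
    have y: "y b \<in> free_mod n (R (Suc i))" if "b < R (Suc i)" for b
      unfolding y_def using that P min_res_free[OF X that] chain_map_free[OF t, of b "Suc i"]
      by (intro free_mod_diff) auto
    have "\<exists>w \<in> free_mod n (R (Suc (Suc i))). lin (R (Suc (Suc i))) (C (Suc i)) w = y b" if b: "b < R (Suc i)" for b
    proof -
      have Cb: "C i b = lin (R (Suc i)) (C i) (unit_vec b)" using b by (simp add: lin_unit_vec)
      have "lin (R (Suc i)) (C i) (lin (R i) s (C i b)) = (\<lambda>a. lin (R i) (t i) (C i b) a - C i b a)"
        using P b unfolding Cb by simp
      moreover have "lin (R i) (t i) (C i b) = lin (R (Suc i)) (C i) (t (Suc i) b)"
        using t b unfolding chain_map_def by blast
      ultimately have "lin (R (Suc i)) (C i) (y b) = (\<lambda>_. 0)"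
        using b unfolding y_def by (simp add: lin_diff lin_unit_vec)
      from min_res_exact[OF X y[OF b] this] show ?thesis by auto
    qed
    then obtain s' where s': "\<And>b. b < R (Suc i) \<Longrightarrow> s' b \<in> free_mod n (R (Suc (Suc i)))"
      "\<And>b. b < R (Suc i) \<Longrightarrow> lin (R (Suc (Suc i))) (C (Suc i)) (s' b) = y b"
      by metis
    have "lin (R (Suc (Suc i))) (C (Suc i)) (lin (R (Suc i)) s' (lin (R (Suc (Suc i))) (C (Suc i)) v))
        = (\<lambda>a. lin (R (Suc i)) (t (Suc i)) (lin (R (Suc (Suc i))) (C (Suc i)) v) a
             - lin (R (Suc (Suc i))) (C (Suc i)) v a)"
      if v: "v \<in> free_mod n (R (Suc (Suc i)))" for v
    proof -
      let ?w = "lin (R (Suc (Suc i))) (C (Suc i)) v"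
      have w: "?w \<in> free_mod n (R (Suc i))" using v min_res_free[OF X] by auto
      have "lin (R (Suc (Suc i))) (C (Suc i)) (lin (R (Suc i)) s' ?w) = lin (R (Suc i)) y ?w"
        unfolding lin_comp using s' by (intro lin_cong) auto
      also have "\<dots> = (\<lambda>a. lin (R (Suc i)) (t (Suc i)) ?w a - ?w a
           - lin (R i) s (lin (R (Suc i)) (C i) ?w) a)"
        unfolding y_def using lin_id[OF w] by (simp add: lin_diff_col lin_comp)
      finally show ?thesis by (simp add: min_res_lin_lin[OF X v])
    qed
    then show "\<exists>s'. ?P (Suc i) s' \<and> ?Q i s s'"
      using s' unfolding y_def by (intro exI[of _ s']) simp
  qed
  then show ?thesis using that by (metis (no_types, lifting))
qed

section \<open>Linear algebra over the coefficient field\<close>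

interpretation fvs: vector_space "\<lambda>(c::'k::field) (f::nat \<Rightarrow> 'k) a. c * f a"
  by unfold_locales (auto simp: algebra_simps)

lemma sum_fun_apply: "(\<Sum>i\<in>A. f i) x = (\<Sum>i\<in>A. f i (x::nat))" for f :: "'i \<Rightarrow> nat \<Rightarrow> 'k::field"
  by (induction A rule: infinite_finite_induct) auto

lemma span_unit_funs:
  fixes v :: "nat \<Rightarrow> 'k::field"
  assumes "finite A" "\<And>a. a \<notin> A \<Longrightarrow> v a = 0"
  shows "v \<in> fvs.span ((\<lambda>a x. if x = a then 1 else 0) ` A)"
proof -
  have "v = (\<Sum>a\<in>A. (\<lambda>x. v a * (if x = a then 1 else 0)))"
    using assms by (intro ext) (auto simp: sum_fun_apply if_distrib cong: if_cong)
  also have "\<dots> \<in> fvs.span ((\<lambda>a x. if x = a then 1 else 0) ` A)"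
    by (intro fvs.span_sum fvs.span_scale fvs.span_base) auto
  finally show ?thesis .
qed

text \<open>The rows of \<open>f\<close> are independent, because multiplying a relation between
  them by \<open>g\<close> isolates each coefficient; and they lie in a space spanned by
  \<open>card A\<close> functions.\<close>

lemma card_le_of_left_inverse:
  fixes f g :: "nat \<Rightarrow> nat \<Rightarrow> 'k::field"
  assumes fin: "finite A" "finite B"
    and inv: "\<And>b b'. b \<in> B \<Longrightarrow> b' \<in> B \<Longrightarrow> (\<Sum>a\<in>A. f b a * g a b') = (if b = b' then 1 else 0)"
  shows "card B \<le> card A"
proof -
  \<comment> \<open>The cut-off puts the rows into the span of the unit functions on
    \<open>A\<close> without changing any sum over \<open>A\<close>.\<close>
  define F where "F = (\<lambda>b a. if a \<in> A then f b a else 0)"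
  have inv': "(\<Sum>a\<in>A. F b a * g a b') = (if b = b' then 1 else 0)" if "b \<in> B" "b' \<in> B" for b b'
    using inv[OF that] by (simp add: F_def)
  have inj: "inj_on F B"
    by (rule inj_onI) (metis inv' zero_neq_one)
  have "fvs.independent (F ` B)"
    unfolding fvs.dependent_finite[OF finite_imageI[OF fin(2)]]
  proof safe
    fix u b assume b: "b \<in> B" and "u (F b) \<noteq> 0" and 0: "(\<Sum>v\<in>F ` B. (\<lambda>a. u v * v a)) = 0"
    have "(\<Sum>b\<in>B. u (F b) * F b a) = 0" for a
      using fun_cong[OF 0, of a] by (simp add: sum_fun_apply sum.reindex[OF inj])
    then have "0 = (\<Sum>a\<in>A. (\<Sum>b'\<in>B. u (F b') * F b' a) * g a b)" by simp
    also have "\<dots> = (\<Sum>a\<in>A. \<Sum>b'\<in>B. u (F b') * (F b' a * g a b))"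
      by (simp add: sum_distrib_right mult.assoc)
    also have "\<dots> = (\<Sum>b'\<in>B. u (F b') * (\<Sum>a\<in>A. F b' a * g a b))"
      by (subst sum.swap) (simp add: sum_distrib_left)
    also have "\<dots> = (\<Sum>b'\<in>B. if b' = b then u (F b') else 0)"
      by (rule sum.cong) (auto simp: inv' b)
    also have "\<dots> = u (F b)" using b fin by simp
    finally show False using \<open>u (F b) \<noteq> 0\<close> by simp
  qed
  moreover have "F ` B \<subseteq> fvs.span ((\<lambda>a x. if x = a then 1 else 0) ` A)"
    by (auto simp: F_def intro!: span_unit_funs[OF fin(1)])
  ultimately have "card (F ` B) \<le> card ((\<lambda>a x. if x = a then 1 else 0 :: 'k) ` A)"
    using fvs.independent_span_bound fin(1) by blast
  then show ?thesis
    using card_image[OF inj] card_image_le[OF fin(1), of "\<lambda>a x. if x = a then 1 else 0 :: 'k"] by simp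
qed

text \<open>Lifts \<open>f\<close> and \<open>g\<close> of the identity of position 0 in both
  directions have a composite homotopic to the identity. Hence their matrices of constant terms in
  degree \<open>j\<close> are inverse on one side. By symmetry one inequality is enough.\<close>

lemma betti_le:
  fixes C C' :: "nat \<Rightarrow> nat \<Rightarrow> nat \<Rightarrow> ('k::field) mpoly"
  assumes X: "min_res n R D C" and X': "min_res n R' D' C'"
    and r0: "R' 0 = R 0" "D' 0 = D 0"
    and im: "lin (R (Suc 0)) (C 0) ` free_mod n (R (Suc 0)) = lin (R' (Suc 0)) (C' 0) ` free_mod n (R' (Suc 0))"
  shows "card {b. b < R (Suc i) \<and> D (Suc i) b = j} \<le> card {a. a < R' (Suc i) \<and> D' (Suc i) a = j}"
proof -
  have u: "hvec n (R 0) (D 0) (D 0 b) (unit_vec b)" if "b < R 0" for b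
    using that by (auto simp: hvec_def unit_vec_def free_mod_def)
  have im1: "C 0 b \<in> lin (R' (Suc 0)) (C' 0) ` free_mod n (R' (Suc 0))" if "b < R (Suc 0)" for b
    using im that by (metis free_mod_unit_vec imageI lin_unit_vec)
  have im2: "C' 0 b \<in> lin (R (Suc 0)) (C 0) ` free_mod n (R (Suc 0))" if "b < R' (Suc 0)" for b
    using im that by (metis free_mod_unit_vec imageI lin_unit_vec)
  have id': "lin (R 0) unit_vec (C' 0 b) = C' 0 b" if "b < R' (Suc 0)" for b
    using lin_id[OF min_res_free[OF X' that]] r0 by simp
  obtain f where f: "f 0 = unit_vec" "chain_map n R D C R' D' C' f"
    by (rule comparison[OF X X', of unit_vec]) (use u r0 im1 lin_id[OF min_res_free[OF X]] in auto)
  obtain g where g: "g 0 = unit_vec" "chain_map n R' D' C' R D C g"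
    by (rule comparison[OF X' X, of unit_vec]) (use u r0 im2 id' in auto)
  define t where "t = (\<lambda>i b. lin (R' i) (g i) (f i b))"
  have t: "chain_map n R D C R D C t"
    unfolding chain_map_def
  proof (intro allI conjI impI)
    show "hvec n (R i) (D i) (D i b) (t i b)" if "b < R i" for i b
      using that f(2) g(2) unfolding t_def chain_map_def by (intro hvec_lin) auto
    fix i b assume "b < R (Suc i)"
    then have "lin (R i) (t i) (C i b) = lin (R' i) (g i) (lin (R' (Suc i)) (C' i) (f (Suc i) b))"
      using f(2) unfolding t_def chain_map_def lin_comp[symmetric] by simp
    then show "lin (R i) (t i) (C i b) = lin (R (Suc i)) (C i) (t (Suc i) b)"
      unfolding t_def chain_map_lin[OF g(2)] .
  qed
  have t0: "t 0 b = unit_vec b" if "b < R 0" for b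
    using that by (simp add: t_def f g r0 lin_unit_vec)
  obtain s where s: "\<And>i b. b < R i \<Longrightarrow> s i b \<in> free_mod n (R (Suc i))" "\<And>b. s 0 b = (\<lambda>_. 0)"
    "\<And>i b. b < R (Suc i) \<Longrightarrow> lin (R (Suc (Suc i))) (C (Suc i)) (s (Suc i) b)
       = (\<lambda>a. t (Suc i) b a - unit_vec b a - lin (R i) (s i) (C i b) a)"
    using homotopy[OF X t t0] by blast
  let ?c = "\<lambda>p. Poly_Mapping.lookup p 0 :: 'k"
  have const: "?c (t (Suc i) b b') = (if b = b' then 1 else 0)" if b: "b < R (Suc i)" "b' < R (Suc i)" for b b'
  proof -
    have "t (Suc i) b b' = lin (R (Suc (Suc i))) (C (Suc i)) (s (Suc i) b) b' + unit_vec b b'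
         + lin (R i) (s i) (C i b) b'"
      using s(3)[OF b(1)] by simp
    moreover have "?c (lin (R (Suc (Suc i))) (C (Suc i)) (s (Suc i) b) b') = 0"
      by (simp add: lin_def lookup_sum lookup_0_mult min_res_lookup[OF X])
    moreover have "?c (lin (R i) (s i) (C i b) b') = 0"
    \<comment> \<open>For \<open>i = 0\<close> the columns of \<open>C 0\<close> may have nonzero
      constant terms; there the summand vanishes because \<open>s 0 = 0\<close>.\<close>
    proof (cases i)
      case 0
      then show ?thesis by (simp add: lin_def s(2))
    next
      case (Suc k)
      with b show ?thesis by (simp add: lin_def lookup_sum lookup_0_mult min_res_lookup[OF X])
    qed
    ultimately show ?thesis by (auto simp: lookup_add unit_vec_def)
  qed
  let ?A = "{a. a < R' (Suc i) \<and> D' (Suc i) a = j}"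
  show ?thesis
  proof (rule card_le_of_left_inverse)
    fix b b' assume b: "b \<in> {b. b < R (Suc i) \<and> D (Suc i) b = j}" and b': "b' \<in> {b. b < R (Suc i) \<and> D (Suc i) b = j}"
    \<comment> \<open>Constant terms of \<open>f\<close> join only basis elements of equal degree,
      so the sum over all intermediate indices reduces to those of degree \<open>j\<close>.\<close>
    have "?c (f (Suc i) b a) = 0" if "a < R' (Suc i)" "D' (Suc i) a \<noteq> j" for a
      using f(2) b that lookup_0_homogeneous[of "f (Suc i) b a" "D (Suc i) b - D' (Suc i) a"]
      unfolding chain_map_def hvec_def by fastforce
    then have "(\<Sum>a\<in>?A. ?c (f (Suc i) b a) * ?c (g (Suc i) a b'))
        = (\<Sum>a<R' (Suc i). ?c (f (Suc i) b a) * ?c (g (Suc i) a b'))"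
      by (intro sum.mono_neutral_left) auto
    also have "\<dots> = ?c (t (Suc i) b b')"
      by (simp add: t_def lin_def lookup_sum lookup_0_mult)
    finally show "(\<Sum>a\<in>?A. ?c (f (Suc i) b a) * ?c (g (Suc i) a b')) = (if b = b' then 1 else 0)"
      using const b b' by simp
  qed auto
qed

section \<open>Extended resolutions versus \<open>minimal_graded_resolution\<close>\<close>

definition scalar_vec :: "('k::field) mpoly \<Rightarrow> nat \<Rightarrow> 'k mpoly" where
  "scalar_vec p = (\<lambda>a. if a = 0 then p else 0)"

text \<open>Position 0 is the ring in degree 0, and \<open>M\<close> is the image itself, not an
  isomorphic copy. Two such complexes can therefore be compared by lifting the identity of the
  ring.\<close>

definition resolves :: "nat \<Rightarrow> ('k::field) mpoly set \<Rightarrow> (nat \<Rightarrow> nat) \<Rightarrow> (nat \<Rightarrow> nat \<Rightarrow> int)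
    \<Rightarrow> (nat \<Rightarrow> nat \<Rightarrow> nat \<Rightarrow> 'k mpoly) \<Rightarrow> bool" where
  "resolves n M R D C \<longleftrightarrow> min_res n R D C \<and> R 0 = 1 \<and> D 0 = (\<lambda>_. 0) \<and>
     lin (R (Suc 0)) (C 0) ` free_mod n (R (Suc 0)) = scalar_vec ` M"

lemma inj_scalar_vec: "inj scalar_vec"
  by (rule injI) (metis scalar_vec_def)

lemma scalar_vec_ext: "v \<in> free_mod n 1 \<Longrightarrow> v = scalar_vec (v 0)"
  by (auto simp: scalar_vec_def free_mod_def fun_eq_iff)

lemma lin_scalar_vec: "lin r (\<lambda>l. scalar_vec (g l)) v = scalar_vec (\<Sum>l<r. v l * g l)"
  by (auto simp: lin_def scalar_vec_def fun_eq_iff)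

text \<open>Dropping the ring in position 0 shifts all indices by one, and columns become matrices
  by exchanging the two indices. Exactness at position 1 turns into exactness at the kernel of the
  augmentation.\<close>

lemma resolution_of_resolves:
  assumes "resolves n M R D C"
  shows "minimal_graded_resolution n M (\<lambda>i. R (Suc i), \<lambda>i. D (Suc i), \<lambda>i a b. C i b a, \<lambda>l. C 0 l 0)"
proof -
  have X: "min_res n R D C" and R0: "R 0 = 1" and D0: "D 0 = (\<lambda>_. 0)"
    and im: "lin (R (Suc 0)) (C 0) ` free_mod n (R (Suc 0)) = scalar_vec ` M"
    using assms by (auto simp: resolves_def)
  have C0: "C 0 b = scalar_vec (C 0 b 0)" if "b < R (Suc 0)" for b
    using min_res_free[OF X that] R0 scalar_vec_ext by metis
  have lin0: "lin (R (Suc 0)) (C 0) v = scalar_vec (\<Sum>l<R (Suc 0). v l * C 0 l 0)" for v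
    unfolding lin_scalar_vec[symmetric] using C0 by (rule lin_cong)
  have app: "apply_mat (R (Suc i)) (R (Suc (Suc i))) (\<lambda>a b. C (Suc i) b a) v = lin (R (Suc (Suc i))) (C (Suc i)) v" for i v
  proof
    fix a
    have "C (Suc i) b a = 0" if "b < R (Suc (Suc i))" "\<not> a < R (Suc i)" for b
      using min_res_free[OF X that(1)] that by (auto simp: free_mod_def)
    then show "apply_mat (R (Suc i)) (R (Suc (Suc i))) (\<lambda>a b. C (Suc i) b a) v a = lin (R (Suc (Suc i))) (C (Suc i)) v a"
      by (auto simp: apply_mat_def lin_def mult.commute)
  qed
  have ex: "{v \<in> free_mod n (R (Suc i)). lin (R (Suc i)) (C i) v = (\<lambda>_. 0)}
       = lin (R (Suc (Suc i))) (C (Suc i)) ` free_mod n (R (Suc (Suc i)))" for i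
    using X by (simp add: min_res_def)
  have M: "M = {(\<Sum>l<R (Suc 0). v l * C 0 l 0) | v. v \<in> free_mod n (R (Suc 0))}"
  proof -
    have "scalar_vec ` M = scalar_vec ` {(\<Sum>l<R (Suc 0). v l * C 0 l 0) | v. v \<in> free_mod n (R (Suc 0))}"
      unfolding im[symmetric] lin0 setcompr_eq_image image_image by simp
    then show ?thesis by (simp only: inj_image_eq_iff[OF inj_scalar_vec])
  qed
  show ?thesis
    unfolding minimal_graded_resolution_def prod.case
  proof (intro conjI allI impI)
    fix l assume l: "l < R (Suc 0)"
    have "scalar_vec (C 0 l 0) \<in> scalar_vec ` M"
      using l C0[OF l] im by (metis free_mod_unit_vec imageI lin_unit_vec)
    then show "C 0 l 0 \<in> M" using inj_scalar_vec by (auto dest: injD)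
    show "homogeneous (C 0 l 0) (D (Suc 0) l)"
      using min_res_hvec[OF X l] R0 D0 by (simp add: hvec_def)
  next
    show "M = {(\<Sum>l<R (Suc 0). v l * C 0 l 0) | v. v \<in> free_mod n (R (Suc 0))}" by (rule M)
  next
    fix i a b :: nat assume i: "1 \<le> i" and a: "a < R (Suc (i - 1))" and b: "b < R (Suc i)"
    then obtain k where k: "i = Suc k" by (cases i) auto
    have "hvec n (R i) (D i) (D (Suc i) b) (C i b)" using min_res_hvec[OF X b] .
    then show "C i b a \<in> polyring n" "homogeneous (C i b a) (D (Suc i) b - D (Suc (i - 1)) a)"
      using a k by (auto simp: hvec_def free_mod_polyring)
    show "Poly_Mapping.lookup (C i b a) 0 = 0"
      using min_res_lookup[OF X] b k by simp
  next
    have "(scalar_vec p = (\<lambda>_. 0)) = (p = 0)" for p :: "'a mpoly"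
      by (auto simp: scalar_vec_def fun_eq_iff)
    then show "{v \<in> free_mod n (R (Suc 0)). (\<Sum>l<R (Suc 0). v l * C 0 l 0) = 0}
          = apply_mat (R (Suc 0)) (R (Suc 1)) (\<lambda>a b. C 1 b a) ` free_mod n (R (Suc 1))"
      using ex[of 0] app[of 0] by (simp add: lin0)
  next
    fix i :: nat assume "1 \<le> i"
    then obtain k where k: "i = Suc k" by (cases i) auto
    show "{v \<in> free_mod n (R (Suc i)). apply_mat (R (Suc (i - 1))) (R (Suc i)) (\<lambda>a b. C i b a) v = (\<lambda>_. 0)}
                 = apply_mat (R (Suc i)) (R (Suc (i + 1))) (\<lambda>a b. C (i + 1) b a) ` free_mod n (R (Suc (i + 1)))"
      using ex[of i] app[of k] app[of i] k by simp
  qed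
qed

lemma resolves_of_resolution:
  assumes res: "minimal_graded_resolution n M (r, d, A, g)" and M: "M \<subseteq> polyring n"
  shows "\<exists>R D C. resolves n M R D C \<and> (\<forall>i. R (Suc i) = r i \<and> D (Suc i) = d i)"
proof -
  define R where "R = case_nat 1 r"
  define D where "D = case_nat (\<lambda>_. 0) d"
  \<comment> \<open>\<open>minimal_graded_resolution\<close> leaves the rows of \<open>A\<close>
    from \<open>r i\<close> on unconstrained, whereas the columns in \<open>min_res\<close> have to
    vanish there.\<close>
  define C where "C = case_nat (\<lambda>l. scalar_vec (g l)) (\<lambda>i b a. if a < r i then A (Suc i) a b else 0)"
  have RS [simp]: "R 0 = 1" "R (Suc i) = r i" "D 0 = (\<lambda>_. 0)" "D (Suc i) = d i" "C 0 = (\<lambda>l. scalar_vec (g l))"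
      "C (Suc i) = (\<lambda>b a. if a < r i then A (Suc i) a b else 0)" for i
    by (auto simp: R_def D_def C_def)
  note res' = res[unfolded minimal_graded_resolution_def prod.case]
  have g: "g l \<in> M" "homogeneous (g l) (d 0 l)" if "l < r 0" for l
    using res'[THEN conjunct1] that by blast+
  have Mim: "M = {(\<Sum>l<r 0. v l * g l) | v. v \<in> free_mod n (r 0)}" by (rule res'[THEN conjunct2, THEN conjunct1])
  have A: "\<forall>i\<ge>1. \<forall>a<r (i - 1). \<forall>b<r i. A i a b \<in> polyring n \<and>
              homogeneous (A i a b) (d i b - d (i - 1) a)" by (rule res'[THEN conjunct2, THEN conjunct2, THEN conjunct1])
  have A': "A (Suc i) a b \<in> polyring n" "homogeneous (A (Suc i) a b) (d (Suc i) b - d i a)" if "a < r i" "b < r (Suc i)" for i a b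
    using A[rule_format, of "Suc i" a b] that by auto
  have e0: "{v \<in> free_mod n (r 0). (\<Sum>l<r 0. v l * g l) = 0}
          = apply_mat (r 0) (r 1) (A 1) ` free_mod n (r 1)" by (rule res'[THEN conjunct2, THEN conjunct2, THEN conjunct2, THEN conjunct1])
  have e: "\<forall>i\<ge>1. {v \<in> free_mod n (r i). apply_mat (r (i - 1)) (r i) (A i) v = (\<lambda>_. 0)}
                 = apply_mat (r i) (r (i + 1)) (A (i + 1)) ` free_mod n (r (i + 1))" by (rule res'[THEN conjunct2, THEN conjunct2, THEN conjunct2, THEN conjunct2, THEN conjunct1])
  have mn: "\<forall>i\<ge>1. \<forall>a<r (i - 1). \<forall>b<r i. Poly_Mapping.lookup (A i a b) 0 = 0" by (rule res'[THEN conjunct2, THEN conjunct2, THEN conjunct2, THEN conjunct2, THEN conjunct2])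
  have lin0: "lin (r 0) (C 0) v = scalar_vec (\<Sum>l<r 0. v l * g l)" for v
    by (simp add: lin_scalar_vec)
  have lin1: "lin (r (Suc i)) (C (Suc i)) v = apply_mat (r i) (r (Suc i)) (A (Suc i)) v" for i v
    by (auto simp: lin_def apply_mat_def fun_eq_iff mult.commute)
  have emb0: "(scalar_vec p = (\<lambda>_. 0)) = (p = 0)" for p :: "'a mpoly"
      by (auto simp: scalar_vec_def fun_eq_iff)
  have "min_res n R D C"
    unfolding min_res_def
  proof (intro conjI allI impI)
    fix i b assume b: "b < R (Suc i)"
    show "hvec n (R i) (D i) (D (Suc i) b) (C i b)"
    proof (cases i)
      case 0
      with b g[of b] M show ?thesis by (auto simp: hvec_def free_mod_def scalar_vec_def)
    next
      case (Suc k)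
      with b A' show ?thesis by (auto simp: hvec_def free_mod_def)
    qed
  next
    fix i
    show "{v \<in> free_mod n (R (Suc i)). lin (R (Suc i)) (C i) v = (\<lambda>_. 0)}
       = lin (R (Suc (Suc i))) (C (Suc i)) ` free_mod n (R (Suc (Suc i)))"
    proof (cases i)
      case 0
      show ?thesis using e0 lin0 lin1[of 0] unfolding 0 RS(2) emb0 by (simp add: emb0 del: RS(5,6))
    next
      case (Suc k)
      show ?thesis using e[rule_format, of i] unfolding Suc RS(2) lin1 by simp
    qed
  next
    fix i a b assume "b < R (Suc (Suc i))"
    then show "Poly_Mapping.lookup (C (Suc i) b a) 0 = 0"
      using mn[rule_format, of "Suc i" a b] by simp
  qed
  moreover have "lin (R (Suc 0)) (C 0) ` free_mod n (R (Suc 0)) = scalar_vec ` M"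
    unfolding RS(2) lin0 by (subst Mim) blast
  ultimately have "resolves n M R D C" by (simp add: resolves_def)
  then show ?thesis by (intro exI[of _ R] exI[of _ D] exI[of _ C]) auto
qed

text \<open>Whatever resolution \<open>SOME\<close> picks can be extended by the ring and compared
  with the given one in both directions by \<open>betti_le\<close>. From here on Betti numbers are
  counts of basis degrees.\<close>

lemma betti_eq:
  assumes X: "resolves n M R D C" and M: "M \<subseteq> polyring n"
  shows "betti n M i j = (if i < 0 then 0 else card {l. l < R (Suc (nat i)) \<and> D (Suc (nat i)) l = j})"
proof (cases "i < 0")
  case True
  then show ?thesis by (simp add: betti_def)
next
  case False
  have ex: "\<exists>res. minimal_graded_resolution n M res" using resolution_of_resolves[OF X] by blast
  obtain r d A g where res: "(SOME res. minimal_graded_resolution n M res) = (r, d, A, g)"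
    by (metis prod_cases4)
  then have "minimal_graded_resolution n M (r, d, A, g)" using someI_ex[OF ex] by simp
  from resolves_of_resolution[OF this M] obtain R' D' C' where
    X': "resolves n M R' D' C'" and r: "\<And>i. R' (Suc i) = r i" "\<And>i. D' (Suc i) = d i" by blast
  have "card {b. b < R (Suc k) \<and> D (Suc k) b = j} = card {a. a < R' (Suc k) \<and> D' (Suc k) a = j}" for k
    using betti_le[of n R D C R' D' C' k j] betti_le[of n R' D' C' R D C k j] X X'
    unfolding resolves_def by (intro antisym) auto
  with False ex res show ?thesis by (simp add: betti_def r)
qed

section \<open>Mapping cones\<close>

text \<open>Direct sums by concatenation, used alike for vectors, for families of degrees and for
  families of columns.\<close>

definition cat :: "nat \<Rightarrow> (nat \<Rightarrow> 'a) \<Rightarrow> (nat \<Rightarrow> 'a) \<Rightarrow> nat \<Rightarrow> 'a" where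
  "cat r v w = (\<lambda>a. if a < r then v a else w (a - r))"

lemma cat_free_mod [simp]: "v \<in> free_mod n r \<Longrightarrow> w \<in> free_mod n s \<Longrightarrow> cat r v w \<in> free_mod n (r + s)"
  by (auto simp: cat_def free_mod_def)

lemma free_mod_catE:
  assumes "v \<in> free_mod n (r + s)"
  obtains e w where "e \<in> free_mod n r" "w \<in> free_mod n s" "v = cat r e w"
proof
  show "(\<lambda>a. if a < r then v a else 0) \<in> free_mod n r" "(\<lambda>a. v (a + r)) \<in> free_mod n s"
    using assms by (auto simp: free_mod_def)
  show "v = cat r (\<lambda>a. if a < r then v a else 0) (\<lambda>a. v (a + r))"
    by (auto simp: cat_def)
qed

lemma sum_lessThan_add: "(\<Sum>b<r + s. f b) = (\<Sum>b<r. f b) + (\<Sum>b<s. f (r + b))" for f :: "nat \<Rightarrow> 'a::comm_monoid_add"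
  by (induction s) (auto simp: add.assoc)

lemma lin_cat: "lin (r + s) (cat r C C') (cat r v w) = (\<lambda>a. lin r C v a + lin s C' w a)"
  by (auto simp: lin_def cat_def sum_lessThan_add)

lemma lin_cat_cols:
  "lin r (\<lambda>b. cat s (C b) (C' b)) v = cat s (lin r C v) (lin r C' v)"
  by (auto simp: lin_def cat_def)

lemma cat_eq_0_iff: "v \<in> free_mod n r \<Longrightarrow> cat r v w = (\<lambda>_. 0) \<longleftrightarrow> v = (\<lambda>_. 0) \<and> w = (\<lambda>_. 0)"
proof safe
  assume v: "v \<in> free_mod n r" and 0: "cat r v w = (\<lambda>_. 0)"
  show "v = (\<lambda>_. 0)"
  proof
    fix a show "v a = 0"
      using fun_cong[OF 0, of a] v by (cases "a < r") (auto simp: cat_def free_mod_def)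
  qed
  show "w = (\<lambda>_. 0)"
  proof
    fix a show "w a = 0" using fun_cong[OF 0, of "r + a"] by (auto simp: cat_def)
  qed
qed (auto simp: cat_def)

lemma cat_add: "(\<lambda>a. cat r v w a + cat r v' w' a) = cat r (\<lambda>a. v a + v' a) (\<lambda>a. w a + w' a)"
  by (auto simp: cat_def)

lemma hvec_cat:
  "hvec n r d e v \<Longrightarrow> hvec n s d' e w \<Longrightarrow> hvec n (r + s) (cat r d d') e (cat r v w)"
  by (auto simp: hvec_def free_mod_def) (auto simp: cat_def)

text \<open>\<open>F\<close> moves up by one position and position 0 is left to \<open>E\<close>
  alone. So if \<open>E\<close> is extended by the ring, the cone is too, and the former position 0
  of \<open>F\<close> becomes a further block of generators.\<close>

definition cone_rank :: "(nat \<Rightarrow> nat) \<Rightarrow> (nat \<Rightarrow> nat) \<Rightarrow> nat \<Rightarrow> nat" where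
  "cone_rank RE RF = case_nat (RE 0) (\<lambda>i. RE (Suc i) + RF i)"

definition cone_deg :: "(nat \<Rightarrow> nat) \<Rightarrow> (nat \<Rightarrow> nat \<Rightarrow> int) \<Rightarrow> (nat \<Rightarrow> nat \<Rightarrow> int) \<Rightarrow> nat \<Rightarrow> nat \<Rightarrow> int" where
  "cone_deg RE DE DF = case_nat (DE 0) (\<lambda>i. cat (RE (Suc i)) (DE (Suc i)) (DF i))"

text \<open>The differential \<open>(e, w) \<mapsto> (d e + f w, - d w)\<close>; the sign makes its
  square vanish, and in the lowest position the second component is absent.\<close>

definition cone_map :: "(nat \<Rightarrow> nat) \<Rightarrow> (nat \<Rightarrow> nat \<Rightarrow> nat \<Rightarrow> ('k::field) mpoly)
    \<Rightarrow> (nat \<Rightarrow> nat \<Rightarrow> nat \<Rightarrow> 'k mpoly) \<Rightarrow> (nat \<Rightarrow> nat \<Rightarrow> nat \<Rightarrow> 'k mpoly) \<Rightarrow> nat \<Rightarrow> nat \<Rightarrow> nat \<Rightarrow> 'k mpoly" where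
  "cone_map RE CE CF f = case_nat (cat (RE 1) (CE 0) (f 0))
     (\<lambda>i. cat (RE (Suc (Suc i))) (\<lambda>b. cat (RE (Suc i)) (CE (Suc i) b) (\<lambda>_. 0))
             (\<lambda>b. cat (RE (Suc i)) (f (Suc i) b) (\<lambda>a. - CF i b a)))"

text \<open>The hypothesis \<open>colon\<close> says that the map induced by \<open>f\<close> on the cokernels in degree 0 is injective.\<close>
lemma min_res_cone:
  fixes CE CF :: "nat \<Rightarrow> nat \<Rightarrow> nat \<Rightarrow> ('k::field) mpoly"
  assumes E: "min_res n RE DE CE" and F: "min_res n RF DF CF"
    and f: "chain_map n RF DF CF RE DE CE f"
    and fmin: "\<And>i b a. b < RF (Suc i) \<Longrightarrow> Poly_Mapping.lookup (f (Suc i) b a) 0 = 0"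
    and Fmin: "\<And>b a. b < RF (Suc 0) \<Longrightarrow> Poly_Mapping.lookup (CF 0 b a) 0 = 0"
    and colon: "\<And>w. w \<in> free_mod n (RF 0) \<Longrightarrow> lin (RF 0) (f 0) w \<in> lin (RE (Suc 0)) (CE 0) ` free_mod n (RE (Suc 0))
        \<Longrightarrow> w \<in> lin (RF (Suc 0)) (CF 0) ` free_mod n (RF (Suc 0))"
  shows "min_res n (cone_rank RE RF) (cone_deg RE DE DF) (cone_map RE CE CF f)"
proof -
  define R where "R = cone_rank RE RF"
  define D where "D = cone_deg RE DE DF"
  define C where "C = cone_map RE CE CF f"
  have RS: "R 0 = RE 0" "R (Suc i) = RE (Suc i) + RF i" for i by (auto simp: R_def cone_rank_def)
  have DS: "D 0 = DE 0" "D (Suc i) = cat (RE (Suc i)) (DE (Suc i)) (DF i)" for i by (auto simp: D_def cone_deg_def)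
  have CS: "C 0 = cat (RE 1) (CE 0) (f 0)"
    "C (Suc i) = cat (RE (Suc (Suc i))) (\<lambda>b. cat (RE (Suc i)) (CE (Suc i) b) (\<lambda>_. 0))
             (\<lambda>b. cat (RE (Suc i)) (f (Suc i) b) (\<lambda>a. - CF i b a))" for i
    by (auto simp: C_def cone_map_def)
  have lin0: "lin (R (Suc 0)) (C 0) (cat (RE (Suc 0)) e w) = (\<lambda>a. lin (RE (Suc 0)) (CE 0) e a + lin (RF 0) (f 0) w a)" for e w
    by (simp add: RS CS lin_cat)
  have linS: "lin (R (Suc (Suc i))) (C (Suc i)) (cat (RE (Suc (Suc i))) e w)
      = cat (RE (Suc i)) (\<lambda>a. lin (RE (Suc (Suc i))) (CE (Suc i)) e a + lin (RF (Suc i)) (f (Suc i)) w a)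
          (\<lambda>a. - lin (RF (Suc i)) (CF i) w a)" for i e w
  proof -
    have "lin r (\<lambda>_ _. 0) v = (\<lambda>_. 0)" for r and v :: "nat \<Rightarrow> 'k mpoly" by (simp add: lin_def)
    moreover have "lin r (\<lambda>b a. - C b a) v = (\<lambda>a. - lin r C v a)" for r C and v :: "nat \<Rightarrow> 'k mpoly"
      by (simp add: lin_def sum_negf)
    ultimately show ?thesis
      by (simp add: RS CS lin_cat lin_cat_cols cat_add)
  qed
  have ff: "lin (RF i) (f i) w \<in> free_mod n (RE i)" if "w \<in> free_mod n (RF i)" for i w
    using that chain_map_free[OF f] by auto
  have Ef: "lin (RE (Suc i)) (CE i) e \<in> free_mod n (RE i)" if "e \<in> free_mod n (RE (Suc i))" for i e
    using that min_res_free[OF E] by auto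
  have Ff: "lin (RF (Suc i)) (CF i) e \<in> free_mod n (RF i)" if "e \<in> free_mod n (RF (Suc i))" for i e
    using that min_res_free[OF F] by auto
  have ker0: "lin (R (Suc i)) (C i) (cat (RE (Suc i)) e w) = (\<lambda>_. 0) \<longleftrightarrow>
      (\<forall>a. lin (RE (Suc i)) (CE i) e a + lin (RF i) (f i) w a = 0) \<and>
      (\<forall>k. i = Suc k \<longrightarrow> lin (RF i) (CF k) w = (\<lambda>_. 0))"
    if "e \<in> free_mod n (RE (Suc i))" "w \<in> free_mod n (RF i)" for i e w
  proof (cases i)
    case 0
    then show ?thesis by (auto simp: lin0 fun_eq_iff)
  next
    case (Suc k)
    have "(\<lambda>a. lin (RE (Suc i)) (CE i) e a + lin (RF i) (f i) w a) \<in> free_mod n (RE i)"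
      using that ff Ef by simp
    with Suc show ?thesis by (simp add: linS cat_eq_0_iff) (auto simp: fun_eq_iff)
  qed
  have "min_res n R D C"
    unfolding min_res_def
  proof (intro conjI allI impI)
    fix i b assume b: "b < R (Suc i)"
    have f': "hvec n (RE i) (DE i) (DF i c) (f i c)" if "c < RF i" for i c
      using f that by (simp add: chain_map_def)
    have neg: "hvec n (RF k) (DF k) e (\<lambda>a. - v a)" if "hvec n (RF k) (DF k) e v" for k e v
      using that by (auto simp: hvec_def intro: homogeneous_uminus)
    have zero: "hvec n (RF k) (DF k) e (\<lambda>_. 0)" for k e by (simp add: hvec_def)
    show "hvec n (R i) (D i) (D (Suc i) b) (C i b)"
    proof (cases i)
      case 0
      with b min_res_hvec[OF E] f'[of _ 0] show ?thesis by (auto simp: RS DS CS cat_def)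
    next
      case (Suc k)
      show ?thesis
      proof (cases "b < RE (Suc i)")
        case True
        then have "D (Suc i) b = DE (Suc i) b" "C i b = cat (RE i) (CE i b) (\<lambda>_. 0)"
          by (auto simp: DS CS Suc cat_def)
        then show ?thesis
          using hvec_cat[OF min_res_hvec[OF E True] zero[of k]] unfolding Suc RS DS by simp
      next
        case False
        then have "D (Suc i) b = DF i (b - RE (Suc i))"
          "C i b = cat (RE i) (f i (b - RE (Suc i))) (\<lambda>a. - CF k (b - RE (Suc i)) a)"
          by (auto simp: DS CS Suc cat_def)
        moreover have "b - RE (Suc i) < RF i" using b False by (simp add: RS)
        moreover from this have "hvec n (RF k) (DF k) (DF i (b - RE (Suc i))) (\<lambda>a. - CF k (b - RE (Suc i)) a)"
          unfolding Suc by (intro neg min_res_hvec[OF F])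
        moreover have "hvec n (RE i) (DE i) (DF i (b - RE (Suc i))) (f i (b - RE (Suc i)))"
          if "b - RE (Suc i) < RF i" using f' that .
        ultimately show ?thesis
          using hvec_cat[of n "RE i" "DE i" _ _ "RF k" "DF k"] unfolding Suc RS DS by simp
      qed
    qed
  next
    fix i
    show "{v \<in> free_mod n (R (Suc i)). lin (R (Suc i)) (C i) v = (\<lambda>_. 0)}
       = lin (R (Suc (Suc i))) (C (Suc i)) ` free_mod n (R (Suc (Suc i)))" (is "?K = ?I")
    proof (intro equalityI subsetI)
      fix v assume v: "v \<in> ?K"
      then obtain e w where ew: "e \<in> free_mod n (RE (Suc i))" "w \<in> free_mod n (RF i)" "v = cat (RE (Suc i)) e w"
        using free_mod_catE[of v n "RE (Suc i)" "RF i"] by (auto simp: RS)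
      then have 1: "\<And>a. lin (RE (Suc i)) (CE i) e a + lin (RF i) (f i) w a = 0"
        and 2: "\<And>k. i = Suc k \<Longrightarrow> lin (RF i) (CF k) w = (\<lambda>_. 0)"
        using v ker0[OF ew(1,2)] by auto
      \<comment> \<open>For \<open>i = 0\<close> there is no cycle condition on \<open>w\<close>;
        instead \<open>f w\<close> is a boundary of \<open>E\<close>, and \<open>colon\<close> plays
        the part of exactness.\<close>
      have "w \<in> lin (RF (Suc i)) (CF i) ` free_mod n (RF (Suc i))"
      proof (cases i)
        case 0
        have "lin (RF 0) (f 0) w = lin (RE (Suc 0)) (CE 0) (\<lambda>a. - e a)"
          using 1 0 by (simp add: lin_uminus fun_eq_iff eq_neg_iff_add_eq_0 add.commute)
        with colon[of w] ew 0 show ?thesis by auto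
      next
        case (Suc k)
        then show ?thesis using min_res_exact[OF F, of w k] 2[OF Suc] ew by simp
      qed
      then obtain w' where w': "w' \<in> free_mod n (RF (Suc i))" "w = lin (RF (Suc i)) (CF i) w'" by auto
      \<comment> \<open>The boundary of \<open>(0, - w')\<close> is \<open>(- f w', w)\<close>. What
        remains of \<open>(e, w)\<close> is \<open>(e + f w', 0)\<close>, whose first component is a
        cycle of \<open>E\<close>.\<close>
      define e1 where "e1 = (\<lambda>a. e a + lin (RF (Suc i)) (f (Suc i)) w' a)"
      have "e1 \<in> free_mod n (RE (Suc i))" using ew w' ff unfolding e1_def by auto
      moreover have "lin (RE (Suc i)) (CE i) e1 = (\<lambda>_. 0)"
        unfolding e1_def lin_add chain_map_lin[OF f, symmetric] w'(2)[symmetric] using 1 by simp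
      ultimately have "e1 \<in> lin (RE (Suc (Suc i))) (CE (Suc i)) ` free_mod n (RE (Suc (Suc i)))"
        by (rule min_res_exact[OF E])
      then obtain e' where e': "e' \<in> free_mod n (RE (Suc (Suc i)))" "e1 = lin (RE (Suc (Suc i))) (CE (Suc i)) e'" by auto
      have "lin (R (Suc (Suc i))) (C (Suc i)) (cat (RE (Suc (Suc i))) e' (\<lambda>a. - w' a)) = v"
        unfolding linS e'(2)[symmetric] lin_uminus ew(3) w'(2)[symmetric] e1_def by simp
      moreover have "cat (RE (Suc (Suc i))) e' (\<lambda>a. - w' a) \<in> free_mod n (R (Suc (Suc i)))"
        using e' w' by (simp add: RS)
      ultimately show "v \<in> ?I" by blast
    next
      fix v assume "v \<in> ?I"
      then obtain u where u: "u \<in> free_mod n (RE (Suc (Suc i)) + RF (Suc i))" "v = lin (R (Suc (Suc i))) (C (Suc i)) u"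
        by (auto simp: RS)
      obtain e w where ew: "e \<in> free_mod n (RE (Suc (Suc i)))" "w \<in> free_mod n (RF (Suc i))" "u = cat (RE (Suc (Suc i))) e w"
        using u(1) by (rule free_mod_catE)
      let ?e = "\<lambda>a. lin (RE (Suc (Suc i))) (CE (Suc i)) e a + lin (RF (Suc i)) (f (Suc i)) w a"
      let ?w = "\<lambda>a. - lin (RF (Suc i)) (CF i) w a"
      have v: "v = cat (RE (Suc i)) ?e ?w" unfolding u(2) ew(3) linS ..
      have ew': "?e \<in> free_mod n (RE (Suc i))" "?w \<in> free_mod n (RF i)" using ew ff Ef Ff by auto
      have "lin (R (Suc i)) (C i) v = (\<lambda>_. 0)"
        unfolding v ker0[OF ew'] lin_add lin_uminus min_res_lin_lin[OF E ew(1)] chain_map_lin[OF f]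
        using min_res_lin_lin[OF F, of w] ew(2) by auto
      then show "v \<in> ?K" using v ew' by (simp add: RS)
    qed
  next
    fix i a b assume b: "b < R (Suc (Suc i))"
    show "Poly_Mapping.lookup (C (Suc i) b a) 0 = 0"
    proof (cases "b < RE (Suc (Suc i))")
      case True
      then show ?thesis using min_res_lookup[OF E] by (auto simp: CS cat_def)
    next
      case False
      then have "b - RE (Suc (Suc i)) < RF (Suc i)" using b by (simp add: RS)
      \<comment> \<open>In \<open>F\<close> the map \<open>CF 0\<close> is exempt from minimality,
        but in the cone it sits one position higher and is not: the case \<open>i = 0\<close> rests
        on \<open>Fmin\<close>.\<close>
      with False fmin Fmin min_res_lookup[OF F] show ?thesis
        by (cases i) (auto simp: CS cat_def)
    qed
  qed
  then show ?thesis by (simp add: R_def D_def C_def)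
qed

lemma chain_map_smult:
  assumes f: "chain_map n RF DF CF RE DE CE f" and u: "u \<in> polyring n" "homogeneous u d"
  shows "chain_map n RF (\<lambda>i b. DF i b + d) CF RE DE CE (\<lambda>i b a. u * f i b a)"
  unfolding chain_map_def
proof (intro conjI allI impI)
  fix i b assume "b < RF i"
  then have "hvec n (RE i) (DE i) (DF i b) (f i b)" using f by (simp add: chain_map_def)
  then have "homogeneous (u * f i b a) (d + (DF i b - DE i a))" "f i b \<in> free_mod n (RE i)" if "a < RE i" for a
    using u that by (auto simp: hvec_def intro!: homogeneous_mult)
  moreover from \<open>hvec n (RE i) (DE i) (DF i b) (f i b)\<close> have "(\<lambda>a. u * f i b a) \<in> free_mod n (RE i)"
    using u by (auto simp: hvec_def)
  ultimately show "hvec n (RE i) (DE i) (DF i b + d) (\<lambda>a. u * f i b a)"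
    by (auto simp: hvec_def algebra_simps)
next
  fix i b assume "b < RF (Suc i)"
  then show "lin (RF i) (\<lambda>b a. u * f i b a) (CF i b) = lin (RE (Suc i)) (CE i) (\<lambda>a. u * f (Suc i) b a)"
    using f by (simp add: chain_map_def lin_smult_col lin_smult)
qed

text \<open>Multiplication by \<open>u * x\<close> induces a map R/J \<rightarrow> R/K, injective
  because \<open>J\<close> is a colon ideal, and its cokernel is the quotient by the sum of
  \<open>K\<close> and \<open>(u * x)\<close>. Only the lift of \<open>x\<close> is taken from
  \<open>comparison\<close>, which \<open>xJ\<close> permits; the factor \<open>u\<close> then
  removes all units from it.\<close>

lemma resolves_cone:
  fixes K J :: "('k::field) mpoly set"
  assumes E: "resolves n K RE DE CE" and F: "resolves n J RF DF CF"
    and x: "x \<in> polyring n" "homogeneous x d" and u: "u \<in> polyring n" "homogeneous u d'" "Poly_Mapping.lookup u 0 = 0"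
    and xJ: "\<And>p. p \<in> J \<Longrightarrow> x * p \<in> K"
    and J: "\<And>p. p \<in> J \<longleftrightarrow> p \<in> polyring n \<and> (u * x) * p \<in> K"
    and Jmin: "\<And>p. p \<in> J \<Longrightarrow> Poly_Mapping.lookup p 0 = 0"
  shows "\<exists>C. resolves n {p + q * (u * x) | p q. p \<in> K \<and> q \<in> polyring n} (cone_rank RE RF)
          (cone_deg RE DE (\<lambda>i b. DF i b + (d + d'))) C"
proof -
  have E': "min_res n RE DE CE" "RE 0 = 1" "DE 0 = (\<lambda>_. 0)"
    and imE: "lin (RE (Suc 0)) (CE 0) ` free_mod n (RE (Suc 0)) = scalar_vec ` K"
    using E by (auto simp: resolves_def)
  have F': "min_res n RF DF CF" "RF 0 = 1" "DF 0 = (\<lambda>_. 0)"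
    and imF: "lin (RF (Suc 0)) (CF 0) ` free_mod n (RF (Suc 0)) = scalar_vec ` J"
    using F by (auto simp: resolves_def)
  \<comment> \<open>Twisted by the degree of \<open>x\<close>, so that multiplication by
    \<open>x\<close> on the ring in position 0 has degree 0; the factor \<open>u\<close> adds
    \<open>d'\<close> later.\<close>
  let ?DF = "\<lambda>i b. DF i b + d"
  have F1: "min_res n RF ?DF CF" using F' by (simp add: min_res_shift)
  have CF0: "\<exists>p\<in>J. CF 0 b = scalar_vec p" if "b < RF (Suc 0)" for b
    using imF that by (metis (no_types, lifting) free_mod_unit_vec imageE imageI lin_unit_vec)
  have lin1: "lin 1 (\<lambda>_. scalar_vec y) (scalar_vec p) = scalar_vec (p * y)" for y p :: "'k mpoly"
    by (auto simp: lin_def scalar_vec_def fun_eq_iff)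
  obtain f where f0: "f 0 = (\<lambda>_. scalar_vec x)" and f: "chain_map n RF ?DF CF RE DE CE f"
  proof (rule comparison[OF F1 E'(1), of "\<lambda>_. scalar_vec x"])
    show "hvec n (RE 0) (DE 0) (?DF 0 b) (scalar_vec x)" for b
      using x E' F' by (auto simp: hvec_def scalar_vec_def free_mod_def)
    show "lin (RF 0) (\<lambda>_. scalar_vec x) (CF 0 b) \<in> lin (RE (Suc 0)) (CE 0) ` free_mod n (RE (Suc 0))"
      if "b < RF (Suc 0)" for b
      using CF0[OF that] xJ unfolding imE F' by (auto simp: lin1[unfolded One_nat_def] mult.commute)
  qed (use that in blast)
  let ?f = "\<lambda>i b a. u * f i b a"
  have DF: "(\<lambda>i b. ?DF i b + d') = (\<lambda>i b. DF i b + (d + d'))" by (simp add: add.assoc)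
  have f': "chain_map n RF (\<lambda>i b. DF i b + (d + d')) CF RE DE CE ?f"
    using chain_map_smult[OF f u(1,2)] unfolding DF .
  have F2: "min_res n RF (\<lambda>i b. DF i b + (d + d')) CF" using F' by (simp add: min_res_shift)
  have uf0: "(\<lambda>b a. u * f 0 b a) = (\<lambda>_. scalar_vec (u * x))"
    by (auto simp: f0 scalar_vec_def fun_eq_iff)
  let ?C = "cone_map RE CE CF ?f"
  have "min_res n (cone_rank RE RF) (cone_deg RE DE (\<lambda>i b. DF i b + (d + d'))) ?C"
  proof (rule min_res_cone[OF E'(1) F2 f'])
    show "Poly_Mapping.lookup (u * f (Suc i) b a) 0 = 0" for i b a
      using u(3) by (simp add: lookup_0_mult)
    show "Poly_Mapping.lookup (CF 0 b a) 0 = 0" if "b < RF (Suc 0)" for b a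
      using CF0[OF that] Jmin by (auto simp: scalar_vec_def)
    fix w assume w: "w \<in> free_mod n (RF 0)"
      and "lin (RF 0) (\<lambda>b a. u * f 0 b a) w \<in> lin (RE (Suc 0)) (CE 0) ` free_mod n (RE (Suc 0))"
    then have "scalar_vec (w 0 * (u * x)) \<in> scalar_vec ` K"
      unfolding imE F' uf0 using scalar_vec_ext[of w n] lin1[of "u * x" "w 0"] w F' by simp
    then have "w 0 * (u * x) \<in> K" using injD[OF inj_scalar_vec] by blast
    \<comment> \<open>Injectivity of R/J \<rightarrow> R/K in the form required by
      \<open>colon\<close>.\<close>
    then have "w 0 \<in> J" using J w by (auto simp: free_mod_polyring mult.commute)
    then show "w \<in> lin (RF (Suc 0)) (CF 0) ` free_mod n (RF (Suc 0))"
      unfolding imF using scalar_vec_ext[of w n] w F' by auto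
  qed
  moreover have "cone_rank RE RF 0 = 1" "cone_deg RE DE (\<lambda>i b. DF i b + (d + d')) 0 = (\<lambda>_. 0)"
    using E' by (auto simp: cone_rank_def cone_deg_def)
  moreover have "lin (cone_rank RE RF (Suc 0)) (?C 0) ` free_mod n (cone_rank RE RF (Suc 0))
      = scalar_vec ` {p + q * (u * x) | p q. p \<in> K \<and> q \<in> polyring n}" (is "?L = ?R")
  proof -
    have *: "lin (cone_rank RE RF (Suc 0)) (?C 0) (cat (RE (Suc 0)) e w)
        = (\<lambda>a. lin (RE (Suc 0)) (CE 0) e a + scalar_vec (w 0 * (u * x)) a)" if "w \<in> free_mod n 1" for e w
      using that scalar_vec_ext[of w n] lin1[of "u * x" "w 0"]
        lin_cat[of "RE (Suc 0)" 1 "CE 0" "\<lambda>_. scalar_vec (u * x)" e w]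
      by (simp add: cone_rank_def cone_map_def uf0 F')
    have rk: "cone_rank RE RF (Suc 0) = RE (Suc 0) + 1" by (simp add: cone_rank_def F')
    have emb_add: "scalar_vec (p + q) = (\<lambda>a. scalar_vec p a + scalar_vec q a)" for p q :: "'k mpoly"
      by (auto simp: scalar_vec_def)
    show ?thesis
    proof (intro equalityI subsetI)
      fix v assume "v \<in> ?L"
      then obtain y where y: "y \<in> free_mod n (RE (Suc 0) + 1)" "v = lin (cone_rank RE RF (Suc 0)) (?C 0) y"
        by (auto simp: rk)
      obtain e w where ew: "e \<in> free_mod n (RE (Suc 0))" "w \<in> free_mod n 1" "y = cat (RE (Suc 0)) e w"
        using y(1) by (rule free_mod_catE)
      have "lin (RE (Suc 0)) (CE 0) e \<in> scalar_vec ` K" using ew imE by blast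
      then obtain p where "p \<in> K" "lin (RE (Suc 0)) (CE 0) e = scalar_vec p" by auto
      then have "v = scalar_vec (p + w 0 * (u * x))" unfolding y(2) ew(3) *[OF ew(2)] emb_add by simp
      then show "v \<in> ?R" using \<open>p \<in> K\<close> ew(2) free_mod_polyring by blast
    next
      fix v assume "v \<in> ?R"
      then obtain p q where v: "v = scalar_vec (p + q * (u * x))" "p \<in> K" "q \<in> polyring n" by auto
      then obtain e where e: "e \<in> free_mod n (RE (Suc 0))" "lin (RE (Suc 0)) (CE 0) e = scalar_vec p"
        using imE by (metis (no_types, lifting) imageE imageI)
      have q: "scalar_vec q \<in> free_mod n 1" using v by (auto simp: scalar_vec_def free_mod_def)
      have v': "v = lin (cone_rank RE RF (Suc 0)) (?C 0) (cat (RE (Suc 0)) e (scalar_vec q))"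
        unfolding *[OF q] e(2) v(1) emb_add using scalar_vec_def[of q] by simp
      have "cat (RE (Suc 0)) e (scalar_vec q) \<in> free_mod n (cone_rank RE RF (Suc 0))"
        unfolding rk using e(1) q by (rule cat_free_mod)
      then show "v \<in> ?L" unfolding v' by (rule imageI)
    qed
  qed
  ultimately show ?thesis unfolding resolves_def by metis
qed

section \<open>Existence of minimal resolutions of squarefree monomial ideals\<close>

definition sqm :: "nat set \<Rightarrow> (nat \<Rightarrow>\<^sub>0 nat)" where
  "sqm T = (\<Sum>i\<in>T. Poly_Mapping.single i 1)"

lemma sqf_mono_sqm: "sqf_mono S = Poly_Mapping.single (sqm S) 1"
  by (simp add: sqf_mono_def sqm_def)

lemma lookup_sqm: "finite T \<Longrightarrow> Poly_Mapping.lookup (sqm T) i = (if i \<in> T then 1 else 0)"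
  by (simp add: sqm_def lookup_sum lookup_single when_def)

lemma keys_sqm: "finite T \<Longrightarrow> Poly_Mapping.keys (sqm T) = T"
  by (auto simp: in_keys_iff lookup_sqm split: if_splits)

lemma sqm_empty [simp]: "sqm {} = 0"
  by (simp add: sqm_def)

lemma mdeg_sqm: "finite T \<Longrightarrow> mdeg (sqm T) = card T"
  by (simp add: mdeg_def keys_sqm lookup_sqm)

text \<open>Subtraction of exponents truncates at 0, so it undoes addition only if all exponents are
  large enough; the inclusion of supports ensures this.\<close>

lemma sqm_minus:
  assumes "S \<subseteq> Poly_Mapping.keys m"
  shows "m = sqm S + (m - sqm S)"
proof (rule poly_mapping_eqI)
  fix i
  have "finite S" using assms finite_subset finite_keys by blast
  then show "Poly_Mapping.lookup m i = Poly_Mapping.lookup (sqm S + (m - sqm S)) i"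
    using assms by (auto simp: lookup_add lookup_minus lookup_sqm in_keys_iff subset_iff Suc_le_eq)
qed

lemma keys_minus_subset: "Poly_Mapping.keys (m - t) \<subseteq> Poly_Mapping.keys m" for m t :: "nat \<Rightarrow>\<^sub>0 nat"
  by (auto simp: in_keys_iff lookup_minus)

lemma sqm_split: "finite T \<Longrightarrow> S \<subseteq> T \<Longrightarrow> sqm T = sqm S + sqm (T - S)"
  unfolding sqm_def by (subst sum.subset_diff[of S T]) (auto simp: add.commute)

text \<open>The coefficients of a vector in multidegree \<open>m\<close>, when the basis elements of the free module
  have the squarefree multidegrees \<open>S l\<close>.\<close>
definition cf :: "(nat \<Rightarrow> nat set) \<Rightarrow> (nat \<Rightarrow> ('k::field) mpoly) \<Rightarrow> (nat \<Rightarrow>\<^sub>0 nat) \<Rightarrow> nat \<Rightarrow> 'k" where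
  "cf S v m = (\<lambda>l. if S l \<subseteq> Poly_Mapping.keys m then Poly_Mapping.lookup (v l) (m - sqm (S l)) else 0)"

text \<open>The coefficient of \<open>v l\<close> at \<open>m\<close> reappears as the
  \<open>l\<close>-th coordinate in multidegree \<open>m + sqm (S l)\<close>.\<close>

lemma cf_inject:
  assumes v: "v \<in> free_mod n r" and w: "w \<in> free_mod n r" and S: "\<And>l. l < r \<Longrightarrow> S l \<subseteq> {..<n}"
    and eq: "\<And>m. Poly_Mapping.keys m \<subseteq> {..<n} \<Longrightarrow> cf S v m = cf S w m"
  shows "v = w"
proof
  fix l
  show "v l = w l"
  proof (cases "l < r")
    case l: True
    show ?thesis
    proof (rule poly_mapping_eqI)
      fix m
      show "Poly_Mapping.lookup (v l) m = Poly_Mapping.lookup (w l) m"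
      proof (cases "Poly_Mapping.keys m \<subseteq> {..<n}")
        case True
        have "finite (S l)" using S[OF l] finite_subset by blast
        then show ?thesis
          using fun_cong[OF eq[of "m + sqm (S l)"], of l] True S[OF l]
          by (simp add: cf_def keys_plus_nat keys_sqm)
      next
        case False
        then show ?thesis
          using free_mod_polyring[OF v, of l] free_mod_polyring[OF w, of l]
          unfolding polyring_def by (metis (mono_tags, lifting) in_keys_iff mem_Collect_eq)
      qed
    qed
  qed (use v w in \<open>auto simp: free_mod_def\<close>)
qed

text \<open>A squarefree submodule is given by its spaces of coefficient vectors \<open>V T\<close>, depending only on the
  support \<open>T\<close> of the multidegree.\<close>
definition sqf_family :: "nat \<Rightarrow> nat \<Rightarrow> (nat \<Rightarrow> nat set) \<Rightarrow> (nat set \<Rightarrow> (nat \<Rightarrow> 'k::field) set) \<Rightarrow> bool" where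
  "sqf_family n r S V \<longleftrightarrow> (\<forall>l<r. S l \<subseteq> {..<n}) \<and> (\<forall>T. fvs.subspace (V T)) \<and>
    (\<forall>T. \<forall>c\<in>V T. \<forall>l. c l \<noteq> 0 \<longrightarrow> l < r \<and> S l \<subseteq> T) \<and> (\<forall>T T'. T \<subseteq> T' \<longrightarrow> V T \<subseteq> V T')"

lemma sqf_familyD:
  assumes "sqf_family n r S V"
  shows "l < r \<Longrightarrow> S l \<subseteq> {..<n}" "fvs.subspace (V T)" "T \<subseteq> T' \<Longrightarrow> V T \<subseteq> V T'"
    "c \<in> V T \<Longrightarrow> c l \<noteq> 0 \<Longrightarrow> l < r \<and> S l \<subseteq> T"
proof -
  note fam = assms[unfolded sqf_family_def]
  show "l < r \<Longrightarrow> S l \<subseteq> {..<n}" by (rule fam[THEN conjunct1, rule_format])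
  show "fvs.subspace (V T)" by (rule fam[THEN conjunct2, THEN conjunct1, rule_format])
  show "c \<in> V T \<Longrightarrow> c l \<noteq> 0 \<Longrightarrow> l < r \<and> S l \<subseteq> T"
    by (rule fam[THEN conjunct2, THEN conjunct2, THEN conjunct1, THEN spec, THEN bspec, THEN spec, THEN mp])
  show "T \<subseteq> T' \<Longrightarrow> V T \<subseteq> V T'"
    by (rule fam[THEN conjunct2, THEN conjunct2, THEN conjunct2, THEN spec, THEN spec, THEN mp])
qed

text \<open>For a \<open>sqf_family\<close> this is a squarefree module: in the coordinates
  \<open>cf\<close>, multiplication by a monomial is the inclusion of one \<open>V T\<close> in
  another, an equality if the support does not grow.\<close>

definition sqf_sub :: "nat \<Rightarrow> nat \<Rightarrow> (nat \<Rightarrow> nat set) \<Rightarrow> (nat set \<Rightarrow> (nat \<Rightarrow> 'k::field) set) \<Rightarrow> (nat \<Rightarrow> 'k mpoly) set" where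
  "sqf_sub n r S V = {v \<in> free_mod n r. \<forall>m. Poly_Mapping.keys m \<subseteq> {..<n} \<longrightarrow> cf S v m \<in> V (Poly_Mapping.keys m)}"

text \<open>A generator is a squarefree multidegree with a coefficient vector. Multiplication by
  monomials does not change coefficient vectors, so generating the module means spanning every
  \<open>V U\<close> by the generators that live below \<open>U\<close>.\<close>

definition sqf_gens :: "nat \<Rightarrow> (nat set \<Rightarrow> (nat \<Rightarrow> 'k::field) set) \<Rightarrow> (nat set \<times> (nat \<Rightarrow> 'k)) set \<Rightarrow> bool" where
  "sqf_gens n V P \<longleftrightarrow> finite P \<and> (\<forall>p\<in>P. fst p \<subseteq> {..<n} \<and> snd p \<in> V (fst p)) \<and>
    (\<forall>U\<subseteq>{..<n}. \<forall>v\<in>V U. \<exists>\<gamma>. v = (\<lambda>l. \<Sum>p\<in>P. \<gamma> p * snd p l) \<and> (\<forall>p\<in>P. \<gamma> p \<noteq> 0 \<longrightarrow> fst p \<subseteq> U))"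

lemma sqf_gens_expand:
  assumes "sqf_gens n V P" "U \<subseteq> {..<n}" "v \<in> V U"
  obtains \<gamma> where "v = (\<lambda>l. \<Sum>p\<in>P. \<gamma> p * snd p l)" "\<And>p. p \<in> P \<Longrightarrow> \<gamma> p \<noteq> 0 \<Longrightarrow> fst p \<subseteq> U"
proof -
  have "\<exists>\<gamma>. v = (\<lambda>l. \<Sum>p\<in>P. \<gamma> p * snd p l) \<and> (\<forall>p\<in>P. \<gamma> p \<noteq> 0 \<longrightarrow> fst p \<subseteq> U)"
    by (rule assms(1)[unfolded sqf_gens_def, THEN conjunct2, THEN conjunct2, rule_format, OF assms(2,3)])
  then show ?thesis using that by (elim exE conjE) simp
qed

text \<open>Each \<open>V U\<close> is finite-dimensional, being supported on \<open>{..<r}\<close>,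
  and there are finitely many \<open>U \<subseteq> {..<n}\<close>. The generators are bases of all
  of these, tagged with \<open>U\<close>.\<close>

lemma sqf_gens_exist:
  fixes V :: "nat set \<Rightarrow> (nat \<Rightarrow> 'k::field) set"
  assumes fam: "sqf_family n r S V"
  shows "\<exists>P. sqf_gens n V P"
proof -
  have "\<exists>B. finite B \<and> B \<subseteq> V U \<and> V U \<subseteq> fvs.span B" for U
  proof -
    obtain B where B: "B \<subseteq> V U" "fvs.independent B" "V U \<subseteq> fvs.span B"
      by (rule fvs.maximal_independent_subset)
    have "B \<subseteq> fvs.span ((\<lambda>a x. if x = a then 1 else 0) ` {..<r})"
    proof
      fix c assume "c \<in> B"
      then have "c l = 0" if "l \<notin> {..<r}" for l
        using that B sqf_familyD(4)[OF fam, of c U l] by blast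
      then show "c \<in> fvs.span ((\<lambda>a x. if x = a then 1 else 0) ` {..<r})"
        by (intro span_unit_funs) auto
    qed
    then have "finite B" using fvs.independent_span_bound B by blast
    with B show ?thesis by blast
  qed
  then obtain B where B: "\<And>U. finite (B U)" "\<And>U. B U \<subseteq> V U" "\<And>U. V U \<subseteq> fvs.span (B U)" by metis
  define P where "P = (SIGMA U:Pow {..<n}. B U)"
  have fin: "finite P" unfolding P_def using B by (intro finite_SigmaI) auto
  have "\<exists>\<gamma>. v = (\<lambda>l. \<Sum>p\<in>P. \<gamma> p * snd p l) \<and> (\<forall>p\<in>P. \<gamma> p \<noteq> 0 \<longrightarrow> fst p \<subseteq> U)"
    if U: "U \<subseteq> {..<n}" and v: "v \<in> V U" for U v
  proof -
    have "v \<in> fvs.span (B U)" using v B by blast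
    then obtain u where u: "v = (\<Sum>c\<in>B U. (\<lambda>l. u c * c l))" unfolding fvs.span_finite[OF B(1)] by auto
    define \<gamma> where "\<gamma> = (\<lambda>p. if fst p = U then u (snd p) else 0)"
    have "v l = (\<Sum>p\<in>P. \<gamma> p * snd p l)" for l
    proof -
      have "v l = (\<Sum>c\<in>B U. u c * c l)" by (simp add: u sum_fun_apply)
      also have "\<dots> = (\<Sum>p\<in>Pair U ` B U. \<gamma> p * snd p l)"
        by (subst sum.reindex) (auto simp: inj_on_def \<gamma>_def)
      also have "\<dots> = (\<Sum>p\<in>P. \<gamma> p * snd p l)"
        by (rule sum.mono_neutral_left[OF fin]) (use U in \<open>auto simp: P_def \<gamma>_def\<close>)
      finally show ?thesis .
    qed
    then show ?thesis by (intro exI[of _ \<gamma>]) (auto simp: \<gamma>_def)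
  qed
  moreover have "\<forall>p\<in>P. fst p \<subseteq> {..<n} \<and> snd p \<in> V (fst p)" using B(2) by (auto simp: P_def)
  ultimately show ?thesis unfolding sqf_gens_def using fin by blast
qed

text \<open>The relation can be solved for \<open>p0\<close>. All other generators in it live below
  \<open>fst p0\<close>, so substituting the solution never leaves the supports allowed in an
  expansion.\<close>

lemma sqf_gens_remove:
  assumes P: "sqf_gens n V P"
    and p0: "p0 \<in> P" "\<gamma> p0 \<noteq> 0" "fst p0 = U"
    and \<gamma>: "\<And>p. p \<in> P \<Longrightarrow> \<gamma> p \<noteq> 0 \<Longrightarrow> fst p \<subseteq> U" "\<And>l. (\<Sum>p\<in>P. \<gamma> p * snd p l) = 0"
  shows "sqf_gens n V (P - {p0})"
  unfolding sqf_gens_def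
proof (intro conjI allI impI ballI)
  show "finite (P - {p0})" using P by (simp add: sqf_gens_def)
  show "fst p \<subseteq> {..<n}" "snd p \<in> V (fst p)" if "p \<in> P - {p0}" for p
    using P that by (auto simp: sqf_gens_def)
  fix W v assume W: "W \<subseteq> {..<n}" and v: "v \<in> V W"
  obtain \<delta> where \<delta>: "v = (\<lambda>l. \<Sum>p\<in>P. \<delta> p * snd p l)" "\<And>p. p \<in> P \<Longrightarrow> \<delta> p \<noteq> 0 \<Longrightarrow> fst p \<subseteq> W"
    by (rule sqf_gens_expand[OF P W v]) (rule that)
  define \<delta>' where "\<delta>' = (\<lambda>p. \<delta> p - \<delta> p0 / \<gamma> p0 * \<gamma> p)"
  have "v l = (\<Sum>p\<in>P - {p0}. \<delta>' p * snd p l)" for l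
  proof -
    have "(\<Sum>p\<in>P - {p0}. \<delta>' p * snd p l) = (\<Sum>p\<in>P. \<delta>' p * snd p l)"
      using P p0 by (intro sum.mono_neutral_left) (auto simp: sqf_gens_def \<delta>'_def)
    also have "\<dots> = v l - \<delta> p0 / \<gamma> p0 * (\<Sum>p\<in>P. \<gamma> p * snd p l)"
      unfolding \<delta>'_def \<delta>(1) by (simp add: left_diff_distrib sum_subtractf sum_distrib_left mult.assoc)
    finally show ?thesis by (simp add: \<gamma>)
  qed
  moreover have "fst p \<subseteq> W" if "p \<in> P - {p0}" "\<delta>' p \<noteq> 0" for p
  proof (cases "\<delta> p = 0")
    case True
    then have "\<delta> p0 \<noteq> 0" "\<gamma> p \<noteq> 0" using that by (auto simp: \<delta>'_def)
    then show ?thesis using \<delta>(2)[OF p0(1)] \<gamma>(1)[of p] p0 that by blast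
  qed (use \<delta>(2) that in auto)
  ultimately show "\<exists>\<gamma>. v = (\<lambda>l. \<Sum>p\<in>P - {p0}. \<gamma> p * snd p l) \<and> (\<forall>p\<in>P - {p0}. \<gamma> p \<noteq> 0 \<longrightarrow> fst p \<subseteq> W)"
    by blast
qed

text \<open>Take a generating set of minimal size: a relation with a unit coefficient would make a generator redundant.\<close>
lemma sqf_gens_minimal:
  fixes V :: "nat set \<Rightarrow> (nat \<Rightarrow> 'k::field) set"
  assumes fam: "sqf_family n r S V"
  obtains r' :: nat and T and c where "\<And>b. b < r' \<Longrightarrow> T b \<subseteq> {..<n} \<and> c b \<in> V (T b)"
    "\<And>U v. U \<subseteq> {..<n} \<Longrightarrow> v \<in> V U \<Longrightarrow>
       \<exists>\<gamma>. v = (\<lambda>l. \<Sum>b<r'. \<gamma> b * c b l) \<and> (\<forall>b. \<gamma> b \<noteq> 0 \<longrightarrow> b < r' \<and> T b \<subseteq> U)"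
    "\<And>U \<gamma> b. (\<And>b. \<gamma> b \<noteq> 0 \<Longrightarrow> b < r' \<and> T b \<subseteq> U) \<Longrightarrow> (\<And>l. (\<Sum>b<r'. \<gamma> b * c b l) = 0)
       \<Longrightarrow> \<gamma> b \<noteq> 0 \<Longrightarrow> T b \<noteq> U"
proof -
  obtain P0 where "sqf_gens n V P0" using sqf_gens_exist[OF fam] by blast
  from ex_has_least_nat[of "sqf_gens n V", OF this, of card]
  obtain P where P: "sqf_gens n V P" and least: "\<And>Q. sqf_gens n V Q \<Longrightarrow> card P \<le> card Q" by blast
  have fin: "finite P" using P by (simp add: sqf_gens_def)
  obtain e where e: "bij_betw e {..<card P} P"
    using ex_bij_betw_nat_finite[OF fin] by (auto simp: atLeast0LessThan)
  have sum_e: "(\<Sum>b<card P. \<gamma> (e b) * snd (e b) l) = (\<Sum>p\<in>P. \<gamma> p * snd p l)" for \<gamma> l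
    by (rule sum.reindex_bij_betw[OF e])
  have eP: "e b \<in> P" if "b < card P" for b using e that by (auto simp: bij_betw_def)
  show ?thesis
  proof (rule that[of "card P" "fst \<circ> e" "snd \<circ> e"])
    show "(fst \<circ> e) b \<subseteq> {..<n} \<and> (snd \<circ> e) b \<in> V ((fst \<circ> e) b)" if "b < card P" for b
      using P eP[OF that] by (simp add: sqf_gens_def)
  next
    fix U v assume U: "U \<subseteq> {..<n}" and v: "v \<in> V U"
    obtain \<gamma> where \<gamma>: "v = (\<lambda>l. \<Sum>p\<in>P. \<gamma> p * snd p l)" "\<And>p. p \<in> P \<Longrightarrow> \<gamma> p \<noteq> 0 \<Longrightarrow> fst p \<subseteq> U"
      by (rule sqf_gens_expand[OF P U v]) (rule that)
    have "v = (\<lambda>l. \<Sum>b<card P. (if b < card P then \<gamma> (e b) else 0) * (snd \<circ> e) b l)"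
      unfolding \<gamma>(1) sum_e[symmetric] by (intro ext sum.cong) auto
    then show "\<exists>\<gamma>. v = (\<lambda>l. \<Sum>b<card P. \<gamma> b * (snd \<circ> e) b l) \<and> (\<forall>b. \<gamma> b \<noteq> 0 \<longrightarrow> b < card P \<and> (fst \<circ> e) b \<subseteq> U)"
      using \<gamma>(2) eP by (intro exI[of _ "\<lambda>b. if b < card P then \<gamma> (e b) else 0"]) auto
  next
    fix U \<gamma> b assume \<gamma>: "\<And>b. \<gamma> b \<noteq> 0 \<Longrightarrow> b < card P \<and> (fst \<circ> e) b \<subseteq> U"
      and 0: "\<And>l. (\<Sum>b<card P. \<gamma> b * (snd \<circ> e) b l) = 0" and b: "\<gamma> b \<noteq> 0"
    define \<delta> where "\<delta> = (\<lambda>p. \<gamma> (the_inv_into {..<card P} e p))"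
    have \<delta>: "\<delta> (e b) = \<gamma> b" if "b < card P" for b
      using e that by (simp add: \<delta>_def bij_betw_def the_inv_into_f_f)
    have sum0: "(\<Sum>p\<in>P. \<delta> p * snd p l) = 0" for l
    proof -
      have "(\<Sum>p\<in>P. \<delta> p * snd p l) = (\<Sum>b<card P. \<gamma> b * (snd \<circ> e) b l)"
        unfolding sum_e[symmetric] by (rule sum.cong) (auto simp: \<delta>)
      then show ?thesis using 0 by simp
    qed
    show "(fst \<circ> e) b \<noteq> U"
    proof
      assume U: "(fst \<circ> e) b = U"
      have bP: "b < card P" using \<gamma>[OF b] by simp
      have "sqf_gens n V (P - {e b})"
      proof (rule sqf_gens_remove[OF P eP[OF bP], of \<delta> U])
        fix p assume "p \<in> P" "\<delta> p \<noteq> 0"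
        then obtain b' where "b' < card P" "p = e b'" using e by (auto simp: bij_betw_def)
        then show "fst p \<subseteq> U" using \<gamma>[of b'] \<open>\<delta> p \<noteq> 0\<close> by (simp add: \<delta>)
      qed (use bP b U sum0 in \<open>auto simp: \<delta>\<close>)
      then have "card P \<le> card (P - {e b})" by (rule least)
      then show False using card_Diff1_less[OF fin eP[OF bP]] by simp
    qed
  qed
qed

text \<open>The monomial in row \<open>l\<close> fills the gap between the multidegrees
  \<open>S l\<close> and \<open>T\<close>, so that the whole column has multidegree \<open>T\<close>
  and coefficient vector \<open>c\<close>.\<close>

definition sqf_col :: "(nat \<Rightarrow> nat set) \<Rightarrow> nat set \<Rightarrow> (nat \<Rightarrow> 'k::field) \<Rightarrow> nat \<Rightarrow> 'k mpoly" where
  "sqf_col S T c = (\<lambda>l. Poly_Mapping.single (sqm (T - S l)) (c l))"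

lemma hvec_sqf_col:
  assumes T: "T \<subseteq> {..<n}" and c: "\<And>l. c l \<noteq> 0 \<Longrightarrow> l < r \<and> S l \<subseteq> T"
  shows "hvec n r (\<lambda>l. int (card (S l))) (int (card T)) (sqf_col S T c)"
  unfolding hvec_def
proof (intro conjI allI impI)
  have fin: "finite T" using T finite_subset by blast
  then have "Poly_Mapping.keys (sqm (T - S l)) \<subseteq> {..<n}" for l using T by (auto simp: keys_sqm)
  moreover have "c l = 0" if "r \<le> l" for l using c[of l] that by force
  ultimately show "sqf_col S T c \<in> free_mod n r" by (auto simp: free_mod_def sqf_col_def)
  fix l
  show "homogeneous (sqf_col S T c l) (int (card T) - int (card (S l)))"
  proof (cases "c l = 0")
    case False
    then have "S l \<subseteq> T" using c by blast
    then have "int (mdeg (sqm (T - S l))) = int (card T) - int (card (S l))"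
      using fin by (simp add: mdeg_sqm card_Diff_subset finite_subset card_mono of_nat_diff)
    then show ?thesis unfolding sqf_col_def using homogeneous_single by metis
  qed (simp add: sqf_col_def)
qed

text \<open>In coordinates the monomials disappear: in every multidegree the map is the same
  constant matrix \<open>c\<close>, the support conditions being absorbed by \<open>cf\<close>.
  Kernels and images thus become linear algebra over the field.\<close>

lemma cf_lin_sqf_col:
  assumes T: "\<And>b. b < r' \<Longrightarrow> T b \<subseteq> {..<n}" and c: "\<And>b l. b < r' \<Longrightarrow> c b l \<noteq> 0 \<Longrightarrow> S l \<subseteq> T b"
  shows "cf S (lin r' (\<lambda>b. sqf_col S (T b) (c b)) w) m l = (\<Sum>b<r'. cf T w m b * c b l)"
proof -
  have *: "(if S l \<subseteq> Poly_Mapping.keys m then Poly_Mapping.lookup (w b * sqf_col S (T b) (c b) l) (m - sqm (S l)) else 0)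
      = cf T w m b * c b l" if b: "b < r'" for b
  proof (cases "c b l = 0")
    case False
    then have S: "S l \<subseteq> T b" using c b by blast
    have fin: "finite (T b)" using T[OF b] finite_subset by blast
    note split = sqm_split[OF fin S]
    show ?thesis
    proof (cases "T b \<subseteq> Poly_Mapping.keys m")
      case True
      have "m = sqm (S l) + (sqm (T b - S l) + (m - sqm (T b)))"
        using sqm_minus[OF True] split by (simp add: add.assoc)
      then have "m - sqm (S l) = sqm (T b - S l) + (m - sqm (T b))"
        by (metis add_diff_cancel_left')
      then have "Poly_Mapping.lookup (w b * sqf_col S (T b) (c b) l) (m - sqm (S l))
          = c b l * Poly_Mapping.lookup (w b) (m - sqm (T b))"
        unfolding sqf_col_def by (simp add: mult.commute[of "w b"] lookup_single_mult)
      then show ?thesis using True S by (auto simp: cf_def mult.commute)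
    next
      case False
      \<comment> \<open>Basis element \<open>b\<close> contributes only to multidegrees above
        \<open>T b\<close>; a nonzero coefficient here would make \<open>m\<close> such a
        multidegree.\<close>
      have "Poly_Mapping.lookup (w b * sqf_col S (T b) (c b) l) (m - sqm (S l)) = 0" if "S l \<subseteq> Poly_Mapping.keys m"
        unfolding sqf_col_def mult.commute[of "w b"]
      proof (rule lookup_single_mult_not)
        fix t show "m - sqm (S l) \<noteq> sqm (T b - S l) + t"
        proof
          assume "m - sqm (S l) = sqm (T b - S l) + t"
          then have "m = sqm (T b) + t" using sqm_minus[OF that] split by (simp add: add.assoc)
          then have "T b \<subseteq> Poly_Mapping.keys m" using fin by (simp add: keys_plus_nat keys_sqm)
          with False show False by blast
        qed
      qed
      then show ?thesis using False by (simp add: cf_def)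
    qed
  qed (simp add: sqf_col_def)
  have "cf S (lin r' (\<lambda>b. sqf_col S (T b) (c b)) w) m l
      = (\<Sum>b<r'. if S l \<subseteq> Poly_Mapping.keys m then Poly_Mapping.lookup (w b * sqf_col S (T b) (c b) l) (m - sqm (S l)) else 0)"
    by (simp add: cf_def lin_def lookup_sum)
  also have "\<dots> = (\<Sum>b<r'. cf T w m b * c b l)"
    by (rule sum.cong) (auto simp: *)
  finally show ?thesis .
qed

text \<open>One step of the resolution, in a form that can be repeated: the kernel of a cover by
  minimal generators is again squarefree, \<open>V'\<close> being the scalar relations between the
  generators below each support. The last clause is minimality of the next differential, whose
  columns lie in this kernel.\<close>

lemma sqf_step:
  fixes V :: "nat set \<Rightarrow> (nat \<Rightarrow> 'k::field) set"
  assumes fam: "sqf_family n r S V"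
  shows "\<exists>r' T K V'. sqf_family n r' T V' \<and>
     (\<forall>b<r'. hvec n r (\<lambda>l. int (card (S l))) (int (card (T b))) (K b)) \<and>
     lin r' K ` free_mod n r' = sqf_sub n r S V \<and>
     {v \<in> free_mod n r'. lin r' K v = (\<lambda>_. 0)} = sqf_sub n r' T V' \<and>
     (\<forall>v\<in>sqf_sub n r' T V'. \<forall>b. Poly_Mapping.lookup (v b) 0 = 0)"
proof -
  obtain r' :: nat and T c where Tc: "\<And>b. b < r' \<Longrightarrow> T b \<subseteq> {..<n} \<and> c b \<in> V (T b)"
    and gen: "\<And>U v. U \<subseteq> {..<n} \<Longrightarrow> v \<in> V U \<Longrightarrow>
       \<exists>\<gamma>. v = (\<lambda>l. \<Sum>b<r'. \<gamma> b * c b l) \<and> (\<forall>b. \<gamma> b \<noteq> 0 \<longrightarrow> b < r' \<and> T b \<subseteq> U)"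
    and mini: "\<And>U \<gamma> b. (\<And>b. \<gamma> b \<noteq> 0 \<Longrightarrow> b < r' \<and> T b \<subseteq> U) \<Longrightarrow> (\<And>l. (\<Sum>b<r'. \<gamma> b * c b l) = 0)
       \<Longrightarrow> \<gamma> b \<noteq> 0 \<Longrightarrow> T b \<noteq> U"
    using sqf_gens_minimal[OF fam] by blast
  note S = sqf_familyD(1)[OF fam] and sub = sqf_familyD(2)[OF fam]
    and mono = sqf_familyD(3)[OF fam] and supp = sqf_familyD(4)[OF fam]
  have c: "c b l \<noteq> 0 \<Longrightarrow> l < r \<and> S l \<subseteq> T b" if "b < r'" for b l using supp Tc that by blast
  define K where "K = (\<lambda>b. sqf_col S (T b) (c b))"
  define V' where "V' = (\<lambda>U. {\<gamma>. (\<forall>b. \<gamma> b \<noteq> 0 \<longrightarrow> b < r' \<and> T b \<subseteq> U) \<and> (\<forall>l. (\<Sum>b<r'. \<gamma> b * c b l) = 0)})"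
  have hK: "hvec n r (\<lambda>l. int (card (S l))) (int (card (T b))) (K b)" if "b < r'" for b
    unfolding K_def by (rule hvec_sqf_col) (use that Tc c in auto)
  have linK: "lin r' K w \<in> free_mod n r" if "w \<in> free_mod n r'" for w
    using that hvec_free_mod[OF hK] by (rule free_mod_lin)
  have cfK: "cf S (lin r' K w) m l = (\<Sum>b<r'. cf T w m b * c b l)" for w m l
    unfolding K_def by (rule cf_lin_sqf_col[of r' T n]) (use Tc c in auto)
  have cfT: "b < r' \<and> T b \<subseteq> Poly_Mapping.keys m" if "w \<in> free_mod n r'" "cf T w m b \<noteq> 0" for w m b
    using that by (cases "b < r'") (auto simp: cf_def free_mod_def split: if_splits)
  have fam': "sqf_family n r' T V'"
    unfolding sqf_family_def
  proof (intro conjI allI impI)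
    show "fvs.subspace (V' U)" for U
    proof (rule fvs.subspaceI)
      show "0 \<in> V' U" by (simp add: V'_def)
      fix \<gamma> \<delta> :: "nat \<Rightarrow> 'k" and a :: 'k
      assume \<gamma>: "\<gamma> \<in> V' U"
      then show "(\<lambda>b. a * \<gamma> b) \<in> V' U"
        by (auto simp: V'_def mult.assoc sum_distrib_left[symmetric])
      assume \<delta>: "\<delta> \<in> V' U"
      have "\<gamma> b \<noteq> 0 \<or> \<delta> b \<noteq> 0" if "(\<gamma> + \<delta>) b \<noteq> 0" for b using that by auto
      with \<gamma> \<delta> show "\<gamma> + \<delta> \<in> V' U"
        unfolding V'_def by (simp add: distrib_right sum.distrib) blast
    qed
    show "T l \<subseteq> {..<n}" if "l < r'" for l using Tc that by blast
  qed (auto simp: V'_def)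
  have img: "lin r' K ` free_mod n r' = sqf_sub n r S V"
  proof (intro equalityI subsetI)
    fix v assume "v \<in> lin r' K ` free_mod n r'"
    then obtain w where w: "w \<in> free_mod n r'" "v = lin r' K w" by blast
    have "cf S v m \<in> V (Poly_Mapping.keys m)" if "Poly_Mapping.keys m \<subseteq> {..<n}" for m
    proof -
      have "cf S v m = (\<Sum>b<r'. (\<lambda>l. cf T w m b * c b l))"
        by (intro ext) (simp add: w(2) cfK sum_fun_apply)
      moreover have "(\<lambda>l. cf T w m b * c b l) \<in> V (Poly_Mapping.keys m)" if "b < r'" for b
      proof (cases "cf T w m b = 0")
        case True
        then show ?thesis using fvs.subspace_0[OF sub] by (simp add: zero_fun_def)
      next
        case False
        then have "c b \<in> V (Poly_Mapping.keys m)" using subsetD[OF mono] cfT[OF w(1) False] Tc[OF that] by blast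
        then show ?thesis by (rule fvs.subspace_scale[OF sub])
      qed
      ultimately show ?thesis by (auto intro: fvs.subspace_sum[OF sub])
    qed
    then show "v \<in> sqf_sub n r S V" using w linK by (auto simp: sqf_sub_def)
  next
    fix v assume v: "v \<in> sqf_sub n r S V"
    \<comment> \<open>The last clause forces zero coefficients in multidegrees where
      \<open>v\<close> vanishes; otherwise the preimage \<open>w\<close> might need infinitely many
      terms.\<close>
    let ?P = "\<lambda>m \<gamma>. cf S v m = (\<lambda>l. \<Sum>b<r'. \<gamma> b * c b l) \<and> (\<forall>b. \<gamma> b \<noteq> 0 \<longrightarrow> b < r' \<and> T b \<subseteq> Poly_Mapping.keys m)
        \<and> (cf S v m = (\<lambda>_. 0) \<longrightarrow> \<gamma> = (\<lambda>_. 0))"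
    have "\<forall>m\<in>{m. Poly_Mapping.keys m \<subseteq> {..<n}}. \<exists>\<gamma>. ?P m \<gamma>"
    proof
      fix m :: "nat \<Rightarrow>\<^sub>0 nat" assume m: "m \<in> {m. Poly_Mapping.keys m \<subseteq> {..<n}}"
      show "\<exists>\<gamma>. ?P m \<gamma>"
      proof (cases "cf S v m = (\<lambda>_. 0)")
        case True
        then show ?thesis by (intro exI[of _ "\<lambda>_. 0"]) simp
      next
        case False
        have "cf S v m \<in> V (Poly_Mapping.keys m)" using v m by (simp add: sqf_sub_def)
        then show ?thesis using gen[of "Poly_Mapping.keys m" "cf S v m"] m False by simp
      qed
    qed
    from bchoice[OF this] obtain \<gamma> where \<gamma>0: "\<forall>m\<in>{m. Poly_Mapping.keys m \<subseteq> {..<n}}. ?P m (\<gamma> m)"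
      by (rule exE)
    note \<gamma>0 = \<gamma>0[THEN bspec, OF CollectI]
    note \<gamma> = \<gamma>0[THEN conjunct1] \<gamma>0[THEN conjunct2, THEN conjunct1, rule_format]
      \<gamma>0[THEN conjunct2, THEN conjunct2, rule_format]
    define N where "N = (\<Union>l<r. (\<lambda>m. m + sqm (S l)) ` Poly_Mapping.keys (v l)) \<inter> {m. Poly_Mapping.keys m \<subseteq> {..<n}}"
    have finN: "finite N" unfolding N_def by simp
    have N: "m \<in> N" if m: "Poly_Mapping.keys m \<subseteq> {..<n}" "cf S v m \<noteq> (\<lambda>_. 0)" for m
    proof -
      obtain l where l: "cf S v m l \<noteq> 0" using m(2) by blast
      then have "S l \<subseteq> Poly_Mapping.keys m" "m - sqm (S l) \<in> Poly_Mapping.keys (v l)"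
        by (auto simp: cf_def in_keys_iff split: if_splits)
      moreover have "l < r" using supp[of "cf S v m" "Poly_Mapping.keys m" l] v m l by (simp add: sqf_sub_def)
      moreover have "m = (m - sqm (S l)) + sqm (S l)"
        using sqm_minus[OF \<open>S l \<subseteq> _\<close>] by (simp add: add.commute)
      ultimately show ?thesis using m(1) unfolding N_def by blast
    qed
    \<comment> \<open>\<open>\<gamma> m b\<close> is placed at the exponent that basis element
      \<open>b\<close> has in multidegree \<open>m\<close>, so that the coordinates of
      \<open>w\<close> become exactly \<open>\<gamma>\<close>.\<close>
    define w where "w = (\<lambda>b. \<Sum>m\<in>{m \<in> N. T b \<subseteq> Poly_Mapping.keys m}. Poly_Mapping.single (m - sqm (T b)) (\<gamma> m b))"
    have w: "w \<in> free_mod n r'"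
      unfolding free_mod_def
    proof (intro CollectI conjI allI impI)
      show "w b \<in> polyring n" for b
        unfolding w_def
      proof (intro polyring_sum polyring_single)
        fix m assume "m \<in> {m \<in> N. T b \<subseteq> Poly_Mapping.keys m}"
        then have "Poly_Mapping.keys m \<subseteq> {..<n}" by (simp add: N_def)
        then show "Poly_Mapping.keys (m - sqm (T b)) \<subseteq> {..<n}" using keys_minus_subset[of m] by blast
      qed
      show "w b = 0" if "r' \<le> b" for b
        unfolding w_def
      proof (intro sum.neutral ballI)
        fix m assume "m \<in> {m \<in> N. T b \<subseteq> Poly_Mapping.keys m}"
        then have "\<gamma> m b = 0" using \<gamma>(2)[of m b] that unfolding N_def by fastforce
        then show "Poly_Mapping.single (m - sqm (T b)) (\<gamma> m b) = 0" by simp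
      qed
    qed
    have cfw: "cf T w m b = \<gamma> m b" if m: "Poly_Mapping.keys m \<subseteq> {..<n}" for m b
    proof (cases "T b \<subseteq> Poly_Mapping.keys m")
      case True
      have inj: "m' - sqm (T b) = m - sqm (T b) \<longleftrightarrow> m' = m" if "T b \<subseteq> Poly_Mapping.keys m'" for m'
        using sqm_minus[OF that] sqm_minus[OF True] by metis
      have "cf T w m b = (\<Sum>m'\<in>{m \<in> N. T b \<subseteq> Poly_Mapping.keys m}. if m' = m then \<gamma> m b else 0)"
        using True unfolding cf_def w_def
        by (auto simp: lookup_sum lookup_single when_def inj intro!: sum.cong)
      also have "\<dots> = (if m \<in> N then \<gamma> m b else 0)"
        using finN True by (simp add: sum.delta)
      also have "\<dots> = \<gamma> m b" using N[OF m] fun_cong[OF \<gamma>(3)[OF m], of b] by auto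
      finally show ?thesis .
    next
      case False
      then show ?thesis using \<gamma>(2)[OF m] by (auto simp: cf_def)
    qed
    have "v = lin r' K w"
    proof (rule cf_inject[of v n r "lin r' K w" S])
      show "v \<in> free_mod n r" using v by (simp add: sqf_sub_def)
      show "cf S v m = cf S (lin r' K w) m" if "Poly_Mapping.keys m \<subseteq> {..<n}" for m
        using \<gamma>(1)[OF that] cfw[OF that] by (simp add: cfK fun_eq_iff)
    qed (use linK w S in auto)
    then show "v \<in> lin r' K ` free_mod n r'" using w by blast
  qed
  have ker: "{v \<in> free_mod n r'. lin r' K v = (\<lambda>_. 0)} = sqf_sub n r' T V'"
  proof -
    have "lin r' K v = (\<lambda>_. 0) \<longleftrightarrow> (\<forall>m. Poly_Mapping.keys m \<subseteq> {..<n} \<longrightarrow> cf T v m \<in> V' (Poly_Mapping.keys m))"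
      if v: "v \<in> free_mod n r'" for v
    proof -
      have "lin r' K v = (\<lambda>_. 0) \<longleftrightarrow> (\<forall>m. Poly_Mapping.keys m \<subseteq> {..<n} \<longrightarrow> cf S (lin r' K v) m = cf S (\<lambda>_. 0) m)"
      proof
        assume "\<forall>m. Poly_Mapping.keys m \<subseteq> {..<n} \<longrightarrow> cf S (lin r' K v) m = cf S (\<lambda>_. 0) m"
        then show "lin r' K v = (\<lambda>_. 0)"
          by (intro cf_inject[OF linK[OF v] free_mod_0, of S] S) auto
      qed simp
      also have "\<dots> \<longleftrightarrow> (\<forall>m. Poly_Mapping.keys m \<subseteq> {..<n} \<longrightarrow> (\<forall>l. (\<Sum>b<r'. cf T v m b * c b l) = 0))"
        by (simp add: fun_eq_iff cfK) (simp add: cf_def)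
      also have "\<dots> \<longleftrightarrow> (\<forall>m. Poly_Mapping.keys m \<subseteq> {..<n} \<longrightarrow> cf T v m \<in> V' (Poly_Mapping.keys m))"
        using cfT[OF v] unfolding V'_def by blast
      finally show ?thesis .
    qed
    then show ?thesis by (auto simp: sqf_sub_def)
  qed
  \<comment> \<open>The constant term of \<open>v b\<close> is its coordinate in the multidegree
    \<open>T b\<close> of the generator itself. If it were nonzero, the relation would make that
    generator redundant.\<close>
  have min0: "Poly_Mapping.lookup (v b) 0 = 0" if v: "v \<in> sqf_sub n r' T V'" for v b
  proof (cases "b < r'")
    case True
    then have T: "T b \<subseteq> {..<n}" "finite (T b)" using Tc finite_subset by blast+
    then have k: "Poly_Mapping.keys (sqm (T b)) = T b" by (simp add: keys_sqm)
    have "cf T v (sqm (T b)) \<in> V' (T b)" using v T k unfolding sqf_sub_def by (metis (mono_tags, lifting) mem_Collect_eq)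
    then have "cf T v (sqm (T b)) b = 0" using mini[of "cf T v (sqm (T b))" "T b" b] unfolding V'_def by blast
    then show ?thesis by (simp add: cf_def k)
  next
    case False
    then show ?thesis using v by (simp add: sqf_sub_def free_mod_def)
  qed
  show ?thesis using fam' hK img ker min0 by blast
qed

text \<open>Iterates \<open>sqf_step\<close>; a state holds a free module, the map from it to the
  previous one and the family to be covered next.\<close>

lemma sqf_sub_resolution:
  fixes V :: "nat set \<Rightarrow> (nat \<Rightarrow> 'k::field) set"
  assumes fam: "sqf_family n r S V"
  obtains R D C where "min_res n R D C" "R 0 = r" "D 0 = (\<lambda>l. int (card (S l)))"
    "lin (R (Suc 0)) (C 0) ` free_mod n (R (Suc 0)) = sqf_sub n r S V"
proof -
  let ?P = "\<lambda>(i::nat) (r', S', K, V'). sqf_family n r' S' V' \<and> (i = 0 \<longrightarrow> r' = r \<and> S' = S \<and> V' = V)"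
  let ?Q = "\<lambda>(i::nat) (r, S, _, V) (r', T, K, V').
     (\<forall>b<r'. hvec n r (\<lambda>l. int (card (S l))) (int (card (T b))) (K b)) \<and>
     lin r' K ` free_mod n r' = sqf_sub n r S V \<and>
     {v \<in> free_mod n r'. lin r' K v = (\<lambda>_. 0)} = sqf_sub n r' T V' \<and>
     (\<forall>v\<in>sqf_sub n r' T V'. \<forall>b. Poly_Mapping.lookup (v b) 0 = 0)"
  have "\<exists>s :: nat \<Rightarrow> nat \<times> (nat \<Rightarrow> nat set) \<times> (nat \<Rightarrow> nat \<Rightarrow> 'k mpoly) \<times> (nat set \<Rightarrow> (nat \<Rightarrow> 'k) set).
      \<forall>i. ?P i (s i) \<and> ?Q i (s i) (s (Suc i))"
  proof (rule dependent_nat_choice)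
    \<comment> \<open>The first free module has no map out of it, hence \<open>undefined\<close>;
      accordingly \<open>C i\<close> is read off from the state at \<open>Suc i\<close>.\<close>
    show "\<exists>s. ?P 0 s" using fam by (intro exI[of _ "(r, S, undefined, V)"]) simp
    fix s i assume "?P i s"
    moreover obtain r0 S0 K0 V0 where s: "s = (r0, S0, K0, V0)" by (cases s) auto
    ultimately have "sqf_family n r0 S0 V0" by simp
    from sqf_step[OF this] obtain r' T K V' where "?Q i s (r', T, K, V')" "sqf_family n r' T V'"
      unfolding s by auto
    then show "\<exists>s'. ?P (Suc i) s' \<and> ?Q i s s'" by (intro exI[of _ "(r', T, K, V')"]) simp
  qed
  then obtain s :: "nat \<Rightarrow> nat \<times> (nat \<Rightarrow> nat set) \<times> (nat \<Rightarrow> nat \<Rightarrow> 'k mpoly) \<times> (nat set \<Rightarrow> (nat \<Rightarrow> 'k) set)"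
    where s: "\<forall>i. ?P i (s i) \<and> ?Q i (s i) (s (Suc i))" by (rule exE)
  define R where "R = (\<lambda>i. fst (s i))"
  define T where "T = (\<lambda>i. fst (snd (s i)))"
  define D where "D = (\<lambda>i l. int (card (T i l)))"
  define C where "C = (\<lambda>i. fst (snd (snd (s (Suc i)))))"
  define W where "W = (\<lambda>i. snd (snd (snd (s i))))"
  have h: "\<And>b. b < R (Suc i) \<Longrightarrow> hvec n (R i) (D i) (D (Suc i) b) (C i b)"
    and img: "lin (R (Suc i)) (C i) ` free_mod n (R (Suc i)) = sqf_sub n (R i) (T i) (W i)"
    and ker: "{v \<in> free_mod n (R (Suc i)). lin (R (Suc i)) (C i) v = (\<lambda>_. 0)} = sqf_sub n (R (Suc i)) (T (Suc i)) (W (Suc i))"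
    and mini: "\<And>v b. v \<in> sqf_sub n (R (Suc i)) (T (Suc i)) (W (Suc i)) \<Longrightarrow> Poly_Mapping.lookup (v b) 0 = 0" for i
    using s[THEN spec, of i] by (auto simp: R_def T_def D_def C_def W_def case_prod_beta)
  have "min_res n R D C"
    unfolding min_res_def
  proof (intro conjI allI impI)
    fix i a b assume b: "b < R (Suc (Suc i))"
    have "C (Suc i) b \<in> lin (R (Suc (Suc i))) (C (Suc i)) ` free_mod n (R (Suc (Suc i)))"
      using b by (metis free_mod_unit_vec imageI lin_unit_vec)
    then show "Poly_Mapping.lookup (C (Suc i) b a) 0 = 0" unfolding img by (rule mini)
  qed (use h img ker in auto)
  moreover have "R 0 = r" "T 0 = S" "W 0 = V"
    using s[THEN spec, of 0] by (auto simp: R_def T_def W_def case_prod_beta)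
  ultimately show ?thesis using that[of R D C] img[of 0] by (simp add: D_def)
qed

text \<open>A squarefree monomial divides \<open>m\<close> exactly if its support lies in that of
  \<open>m\<close>. In this form membership depends on supports only, as \<open>sqf_sub\<close>
  requires.\<close>

definition mon_ideal :: "nat \<Rightarrow> nat set set \<Rightarrow> ('k::field) mpoly set" where
  "mon_ideal n G = {p \<in> polyring n. \<forall>m\<in>Poly_Mapping.keys p. \<exists>g\<in>G. g \<subseteq> Poly_Mapping.keys m}"

text \<open>An ideal sits in the free module of rank one with basis in multidegree
  \<open>{}\<close>. Its coordinate space over \<open>U\<close> is the field if some generator lies
  in \<open>U\<close>, and zero otherwise.\<close>

lemma mon_ideal_resolves: "\<exists>R D C. resolves n (mon_ideal n G :: ('k::field) mpoly set) R D C"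
proof -
  define V :: "nat set \<Rightarrow> (nat \<Rightarrow> 'k) set" where
    "V = (\<lambda>U. {c. (\<forall>l. c l \<noteq> 0 \<longrightarrow> l = 0) \<and> (c 0 \<noteq> 0 \<longrightarrow> (\<exists>g\<in>G. g \<subseteq> U))})"
  have "sqf_family n 1 (\<lambda>_. {}) V"
    unfolding sqf_family_def
  proof (intro conjI allI impI)
    show "fvs.subspace (V U)" for U
      unfolding V_def by (rule fvs.subspaceI) (auto, (metis add_0)+)
  qed (auto simp: V_def)
  then obtain R D C where X: "min_res n R D C" "R 0 = 1" "D 0 = (\<lambda>_. 0)"
    "lin (R (Suc 0)) (C 0) ` free_mod n (R (Suc 0)) = sqf_sub n 1 (\<lambda>_. {}) V"
    by (rule sqf_sub_resolution) simp
  have "sqf_sub n 1 (\<lambda>_. {}) V = scalar_vec ` mon_ideal n G"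
  proof -
    have *: "scalar_vec p \<in> sqf_sub n 1 (\<lambda>_. {}) V \<longleftrightarrow> p \<in> mon_ideal n G" for p
    proof -
      have "scalar_vec p \<in> free_mod n 1 \<longleftrightarrow> p \<in> polyring n" by (auto simp: scalar_vec_def free_mod_def)
      moreover have "cf (\<lambda>_. {}) (scalar_vec p) m = (\<lambda>l. if l = 0 then Poly_Mapping.lookup p m else 0)" for m
        by (auto simp: cf_def scalar_vec_def)
      ultimately show ?thesis
        unfolding sqf_sub_def mon_ideal_def V_def by (auto simp: in_keys_iff polyring_def)
    qed
    have "v \<in> scalar_vec ` mon_ideal n G" if "v \<in> sqf_sub n 1 (\<lambda>_. {}) V" for v
    proof -
      have "v = scalar_vec (v 0)" using that scalar_vec_ext[of v n] by (simp add: sqf_sub_def)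
      then show ?thesis using *[of "v 0"] that by auto
    qed
    with * show ?thesis by blast
  qed
  with X show ?thesis unfolding resolves_def by auto
qed

section \<open>Monomial ideals\<close>

lemma mon_ideal_add: "p \<in> mon_ideal n G \<Longrightarrow> q \<in> mon_ideal n G \<Longrightarrow> p + q \<in> mon_ideal n G"
  unfolding mon_ideal_def using Poly_Mapping.keys_add[of p q] by auto

lemma mon_ideal_sum: "(\<And>a. a \<in> A \<Longrightarrow> f a \<in> mon_ideal n G) \<Longrightarrow> sum f A \<in> mon_ideal n G"
  by (induction A rule: infinite_finite_induct) (auto intro: mon_ideal_add, auto simp: mon_ideal_def)

lemma keys_sqf_mono_mult:
  assumes "finite g"
  shows "Poly_Mapping.keys (sqf_mono g * p) = (\<lambda>m. sqm g + m) ` Poly_Mapping.keys (p :: ('k::field) mpoly)"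
proof (intro equalityI subsetI)
  fix m assume m: "m \<in> Poly_Mapping.keys (sqf_mono g * p)"
  then obtain t where t: "m = sqm g + t"
    using lookup_single_mult_not[of m "sqm g" 1 p] unfolding sqf_mono_sqm in_keys_iff by blast
  with m have "t \<in> Poly_Mapping.keys p"
    by (simp add: in_keys_iff sqf_mono_sqm lookup_single_mult)
  with t show "m \<in> (\<lambda>m. sqm g + m) ` Poly_Mapping.keys p" by blast
qed (auto simp: in_keys_iff sqf_mono_sqm lookup_single_mult)

text \<open>Multiplication by the monomial of \<open>g\<close> adds \<open>g\<close> to every
  support. With \<open>g = h\<close> this computes the colon ideal, with \<open>g = {z}\<close> it
  reduces \<open>x J \<subseteq> K\<close> to the exchange property.\<close>

lemma sqf_mono_mult_mem_mon_ideal: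
  assumes "g \<subseteq> {..<n}"
  shows "sqf_mono g * p \<in> mon_ideal n G \<longleftrightarrow>
    p \<in> polyring n \<and> (\<forall>m\<in>Poly_Mapping.keys p. \<exists>g'\<in>G. g' \<subseteq> g \<union> Poly_Mapping.keys m)"
proof -
  have "finite g" using assms finite_subset by blast
  then show ?thesis
    using assms by (auto simp: mon_ideal_def polyring_def keys_sqf_mono_mult keys_plus_nat keys_sqm)
qed

lemma polyring_sqf_mono: "g \<subseteq> {..<n} \<Longrightarrow> sqf_mono g \<in> polyring n"
  using finite_subset[of g "{..<n}"] by (simp add: sqf_mono_sqm keys_sqm)

lemma gen_ideal_eq_mon_ideal:
  assumes G: "\<And>g. g \<in> G \<Longrightarrow> g \<subseteq> {..<n}"
  shows "gen_ideal n (sqf_mono ` G) = (mon_ideal n G :: ('k::field) mpoly set)"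
proof (intro equalityI subsetI)
  fix p :: "'k mpoly" assume "p \<in> gen_ideal n (sqf_mono ` G)"
  then obtain F c where F: "p = (\<Sum>s\<in>F. c s * s)" "F \<subseteq> sqf_mono ` G" "\<forall>s\<in>F. c s \<in> polyring n"
    unfolding gen_ideal_def by auto
  show "p \<in> mon_ideal n G"
    unfolding F(1)
  proof (rule mon_ideal_sum)
    fix s assume "s \<in> F"
    then obtain g where "g \<in> G" "s = sqf_mono g" "c s \<in> polyring n" using F by blast
    then show "c s * s \<in> mon_ideal n G"
      using sqf_mono_mult_mem_mon_ideal[OF G, of g "c s" G] by (auto simp: mult.commute)
  qed
next
  fix p :: "'k mpoly" assume p: "p \<in> mon_ideal n G"
  then have "\<forall>m\<in>Poly_Mapping.keys p. \<exists>g. g \<in> G \<and> g \<subseteq> Poly_Mapping.keys m"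
    unfolding mon_ideal_def by blast
  from bchoice[OF this] obtain \<phi> where
    \<phi>: "\<And>m. m \<in> Poly_Mapping.keys p \<Longrightarrow> \<phi> m \<in> G \<and> \<phi> m \<subseteq> Poly_Mapping.keys m" by blast
  define F where "F = (\<lambda>m. sqf_mono (\<phi> m) :: 'k mpoly) ` Poly_Mapping.keys p"
  \<comment> \<open>\<open>gen_ideal\<close> attaches one coefficient to each generator, so the
    monomials assigned to the same generator are collected.\<close>
  define c where "c = (\<lambda>s :: 'k mpoly. \<Sum>m | m \<in> Poly_Mapping.keys p \<and> sqf_mono (\<phi> m) = s.
      Poly_Mapping.single (m - sqm (\<phi> m)) (Poly_Mapping.lookup p m))"
  have "p = (\<Sum>m\<in>Poly_Mapping.keys p. Poly_Mapping.single m (Poly_Mapping.lookup p m))"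
    by (rule poly_sum_single) auto
  also have "\<dots> = (\<Sum>m\<in>Poly_Mapping.keys p. Poly_Mapping.single (m - sqm (\<phi> m)) (Poly_Mapping.lookup p m) * sqf_mono (\<phi> m))"
  proof (rule sum.cong[OF refl])
    fix m assume "m \<in> Poly_Mapping.keys p"
    then have "m = sqm (\<phi> m) + (m - sqm (\<phi> m))" using \<phi> sqm_minus by blast
    then show "Poly_Mapping.single m (Poly_Mapping.lookup p m)
        = Poly_Mapping.single (m - sqm (\<phi> m)) (Poly_Mapping.lookup p m) * sqf_mono (\<phi> m)"
      by (metis add.commute mult.right_neutral mult_single sqf_mono_sqm)
  qed
  also have "\<dots> = (\<Sum>s\<in>F. \<Sum>m | m \<in> Poly_Mapping.keys p \<and> sqf_mono (\<phi> m) = s.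
      Poly_Mapping.single (m - sqm (\<phi> m)) (Poly_Mapping.lookup p m) * sqf_mono (\<phi> m))"
    unfolding F_def by (rule sum.image_gen) simp
  also have "\<dots> = (\<Sum>s\<in>F. c s * s)"
    unfolding c_def sum_distrib_right by (intro sum.cong) auto
  finally have "p = (\<Sum>s\<in>F. c s * s)" .
  moreover have "finite F" "F \<subseteq> sqf_mono ` G" using \<phi> by (auto simp: F_def)
  moreover have "c s \<in> polyring n" for s
    unfolding c_def
  proof (intro polyring_sum polyring_single)
    fix m assume "m \<in> {m \<in> Poly_Mapping.keys p. sqf_mono (\<phi> m) = s}"
    then have "Poly_Mapping.keys m \<subseteq> {..<n}" using p by (auto simp: mon_ideal_def polyring_def)
    then show "Poly_Mapping.keys (m - sqm (\<phi> m)) \<subseteq> {..<n}"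
      using keys_minus_subset by blast
  qed
  ultimately show "p \<in> gen_ideal n (sqf_mono ` G)" unfolding gen_ideal_def by blast
qed

lemma sqf_mono_dvd_mon_ideal:
  fixes p :: "('k::field) mpoly"
  assumes g: "g \<subseteq> {..<n}" and p: "p \<in> mon_ideal n {g}"
  obtains q where "q \<in> polyring n" "p = sqf_mono g * q"
proof -
  have "p \<in> gen_ideal n (sqf_mono ` {g})" using p g gen_ideal_eq_mon_ideal[of "{g}" n, where 'k = 'k] by simp
  then obtain F c where F: "p = (\<Sum>s\<in>F. c s * s)" "F \<subseteq> {sqf_mono g}" "\<forall>s\<in>F. c s \<in> polyring n"
    unfolding gen_ideal_def by auto
  have "p = sqf_mono g * (\<Sum>s\<in>F. c s)"
    unfolding F(1) sum_distrib_left using F(2) by (intro sum.cong) auto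
  then show ?thesis using that[of "\<Sum>s\<in>F. c s"] F(3) by simp
qed

text \<open>Monomials divisible by a generator from \<open>A\<close> go to the first summand; all
  others must be divisible by one from \<open>B\<close>.\<close>

lemma mon_ideal_UnE:
  fixes p :: "('k::field) mpoly"
  assumes p: "p \<in> mon_ideal n (A \<union> B)"
  obtains p1 p2 where "p1 \<in> mon_ideal n A" "p2 \<in> mon_ideal n B" "p = p1 + p2"
proof -
  let ?P = "\<lambda>m. \<exists>g\<in>A. g \<subseteq> Poly_Mapping.keys m"
  define q where "q = (\<lambda>M. \<Sum>m\<in>M. Poly_Mapping.single m (Poly_Mapping.lookup p m))"
  have q: "Poly_Mapping.lookup (q M) m = (if m \<in> M then Poly_Mapping.lookup p m else 0)" if "finite M" for M m
    using that by (auto simp: q_def lookup_sum lookup_single when_def)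
  let ?M = "{m \<in> Poly_Mapping.keys p. ?P m}" and ?N = "{m \<in> Poly_Mapping.keys p. \<not> ?P m}"
  have "p = q ?M + q ?N"
    by (rule poly_mapping_eqI) (auto simp: lookup_add q in_keys_iff)
  moreover have keys_q: "Poly_Mapping.keys (q M) = M" if "M \<subseteq> Poly_Mapping.keys p" for M
    using that finite_subset[OF that] by (auto simp: in_keys_iff q split: if_splits)
  have "q ?M \<in> mon_ideal n A" "q ?N \<in> mon_ideal n B"
  proof -
    have gen: "\<exists>g\<in>A \<union> B. g \<subseteq> Poly_Mapping.keys m" if "m \<in> Poly_Mapping.keys p" for m
      using p that by (simp add: mon_ideal_def)
    have "\<exists>g\<in>B. g \<subseteq> Poly_Mapping.keys m" if "m \<in> ?N" for m
      using gen[of m] that by (simp add: bex_Un)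
    then show "q ?M \<in> mon_ideal n A" "q ?N \<in> mon_ideal n B"
      using p unfolding mon_ideal_def polyring_def by (simp_all add: keys_q)
  qed
  ultimately show ?thesis using that by blast
qed

lemma mon_ideal_subset_polyring: "mon_ideal n G \<subseteq> polyring n"
  by (auto simp: mon_ideal_def)

section \<open>The Betti splitting\<close>

lemma sqf_mono_union:
  "finite S \<Longrightarrow> finite T \<Longrightarrow> S \<inter> T = {} \<Longrightarrow> sqf_mono (S \<union> T) = (sqf_mono S * sqf_mono T :: ('k::field) mpoly)"
  by (simp add: sqf_mono_sqm mult_single sqm_def sum.union_disjoint)

text \<open>Multiplication by \<open>h \<noteq> 0\<close> is injective, so \<open>h J\<close> is a
  twist of \<open>J\<close>: only the augmentation and the degrees change, the ring in position 0
  keeping degree 0.\<close>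

lemma resolves_scale:
  fixes J :: "('k::field) mpoly set"
  assumes F: "resolves n J RF DF CF" and h: "h \<in> polyring n" "homogeneous h d"
    and "h \<noteq> 0"
  shows "resolves n ((*) h ` J) RF (\<lambda>i b. if i = 0 then 0 else DF i b + d) (CF(0 := \<lambda>b a. h * CF 0 b a))"
proof -
  let ?D = "\<lambda>i b. if i = 0 then 0 else DF i b + d"
  let ?C = "CF(0 := \<lambda>b a. h * CF 0 b a)"
  have F': "min_res n RF DF CF" "RF 0 = 1" "DF 0 = (\<lambda>_. 0)"
    "lin (RF (Suc 0)) (CF 0) ` free_mod n (RF (Suc 0)) = scalar_vec ` J"
    using F by (auto simp: resolves_def)
  have lin0: "lin (RF (Suc 0)) (?C 0) v = (\<lambda>a. h * lin (RF (Suc 0)) (CF 0) v a)" for v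
    by (simp add: lin_smult_col)
  have "min_res n RF ?D ?C"
    unfolding min_res_def
  proof (intro conjI allI impI)
    fix i b assume b: "b < RF (Suc i)"
    show "hvec n (RF i) (?D i) (?D (Suc i) b) (?C i b)"
    proof (cases i)
      case 0
      have "hvec n (RF 0) (DF 0) (DF (Suc 0) b) (CF 0 b)" using min_res_hvec[OF F'(1)] b 0 by blast
      then show ?thesis
        using h homogeneous_mult[OF h(2), of "CF 0 b 0" "DF (Suc 0) b"] unfolding 0
        by (auto simp: hvec_def F' add.commute)
    next
      case (Suc k)
      then show ?thesis using min_res_hvec[OF F'(1) b] by (simp add: hvec_def)
    qed
  next
    fix i
    have "lin (RF (Suc i)) (?C i) v = (\<lambda>_. 0) \<longleftrightarrow> lin (RF (Suc i)) (CF i) v = (\<lambda>_. 0)" for v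
    proof (cases i)
      case 0
      with \<open>h \<noteq> 0\<close> show ?thesis unfolding 0 lin0 by (simp add: fun_eq_iff)
    qed simp
    then show "{v \<in> free_mod n (RF (Suc i)). lin (RF (Suc i)) (?C i) v = (\<lambda>_. 0)}
       = lin (RF (Suc (Suc i))) (?C (Suc i)) ` free_mod n (RF (Suc (Suc i)))"
      using F'(1) unfolding min_res_def by simp
  next
    fix i a b assume "b < RF (Suc (Suc i))"
    then show "Poly_Mapping.lookup (?C (Suc i) b a) 0 = 0" using min_res_lookup[OF F'(1)] by simp
  qed
  moreover have "lin (RF (Suc 0)) (?C 0) ` free_mod n (RF (Suc 0)) = scalar_vec ` (*) h ` J"
  proof -
    have "(\<lambda>a. h * scalar_vec p a) = scalar_vec (h * p)" for p by (auto simp: scalar_vec_def)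
    then have "(\<lambda>v a. h * v a) ` scalar_vec ` J = scalar_vec ` (*) h ` J" by (simp add: image_image)
    then show ?thesis unfolding lin0 F'(4)[symmetric] by (simp add: image_image)
  qed
  ultimately show ?thesis using F' by (simp add: resolves_def)
qed

text \<open>Multiplication by \<open>h \<noteq> 0\<close> is injective, so the complex ends with a
  single generator in position 1.\<close>

lemma resolves_principal:
  fixes h :: "('k::field) mpoly"
  assumes h: "h \<in> polyring n" "homogeneous h d" and "h \<noteq> 0"
  shows "resolves n {h * q | q. q \<in> polyring n} (\<lambda>i. if i \<le> 1 then 1 else 0) (\<lambda>i b. if i = 0 then 0 else d)
    (\<lambda>i b. scalar_vec h)"
proof -
  have lin1: "lin 1 (\<lambda>_. scalar_vec h) v = scalar_vec (h * v 0)" for v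
    by (auto simp: lin_def scalar_vec_def fun_eq_iff mult.commute)
  have fm0: "free_mod n 0 = {\<lambda>_. 0}" by (auto simp: free_mod_def)
  have "scalar_vec (h * v 0) = (\<lambda>_. 0) \<longleftrightarrow> v = (\<lambda>_. 0)" if "v \<in> free_mod n 1" for v
  proof -
    have emb0: "scalar_vec p = (\<lambda>_. 0) \<longleftrightarrow> p = 0" for p :: "'k mpoly" by (auto simp: scalar_vec_def fun_eq_iff)
    have "v = (\<lambda>_. 0) \<longleftrightarrow> v 0 = 0" using scalar_vec_ext[OF that] emb0[of "v 0"] by simp
    with \<open>h \<noteq> 0\<close> show ?thesis by (simp add: emb0)
  qed
  moreover have "scalar_vec (0 :: 'k mpoly) = (\<lambda>_. 0)" by (auto simp: scalar_vec_def)
  ultimately have ker: "{v \<in> free_mod n 1. scalar_vec (h * v 0) = (\<lambda>_. 0)} = {\<lambda>_. 0}"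
    by auto
  have "(polyring n :: 'k mpoly set) \<subseteq> (\<lambda>v. v 0) ` free_mod n 1"
  proof
    fix q :: "'k mpoly" assume "q \<in> polyring n"
    then have "q = scalar_vec q 0" "scalar_vec q \<in> free_mod n 1" by (auto simp: scalar_vec_def free_mod_def)
    then show "q \<in> (\<lambda>v. v 0) ` free_mod n 1" by (rule image_eqI)
  qed
  then have "(\<lambda>v. v 0) ` free_mod n 1 = (polyring n :: 'k mpoly set)"
    using free_mod_polyring by auto
  then have "scalar_vec ` (*) h ` (\<lambda>v. v 0) ` free_mod n 1 = scalar_vec ` {h * q | q. q \<in> polyring n}"
    by (simp add: setcompr_eq_image)
  moreover have "lin 1 (\<lambda>_. scalar_vec h) = (\<lambda>v. scalar_vec (h * v 0))"
    by (rule ext) (rule lin1)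
  ultimately have img: "lin 1 (\<lambda>_. scalar_vec h) ` free_mod n 1 = scalar_vec ` {h * q | q. q \<in> polyring n}"
    by (simp only: image_image)
  let ?R = "\<lambda>i :: nat. if i \<le> 1 then 1 else 0 :: nat" and ?D = "\<lambda>i b :: nat. if i = 0 then 0 else d"
  have "min_res n ?R ?D (\<lambda>i b. scalar_vec h)"
    unfolding min_res_def
  proof (intro conjI allI impI)
    fix i b assume "b < ?R (Suc i)"
    then have "i = 0" by (simp split: if_splits)
    then show "hvec n (?R i) (?D i) (?D (Suc i) b) (scalar_vec h)"
      using h by (simp add: hvec_def scalar_vec_def free_mod_def)
  next
    fix i
    show "{v \<in> free_mod n (?R (Suc i)). lin (?R (Suc i)) (\<lambda>b. scalar_vec h) v = (\<lambda>_. 0)}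
       = lin (?R (Suc (Suc i))) (\<lambda>b. scalar_vec h) ` free_mod n (?R (Suc (Suc i)))"
    proof (cases i)
      case 0
      have "{v \<in> free_mod n 1. lin 1 (\<lambda>_. scalar_vec h) v = (\<lambda>_. 0)} = {\<lambda>_. 0}"
        using ker by (simp only: lin1)
      then show ?thesis by (simp add: 0 fm0)
    next
      case (Suc k)
      have "{v. v = (\<lambda>_. 0) \<and> lin 0 (\<lambda>b. scalar_vec h) v = (\<lambda>_. 0)} = {\<lambda>_. 0}"
        using lin_0 by blast
      then show ?thesis by (simp add: Suc fm0)
    qed
  qed simp
  then show ?thesis using img by (simp add: resolves_def)
qed

lemma homogeneous_sqf_mono: "finite g \<Longrightarrow> homogeneous (sqf_mono g :: ('k::field) mpoly) (int (card g))"
  unfolding sqf_mono_sqm using homogeneous_single[of "sqm g" "1::'k"] by (simp add: mdeg_sqm)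

lemma card_cat: "card {l. l < r + s \<and> cat r d d' l = j} = card {l. l < r \<and> d l = j} + card {l. l < s \<and> d' l = j}"
proof -
  have "{l. l < r + s \<and> cat r d d' l = j} = {l. l < r \<and> d l = j} \<union> (+) r ` {l. l < s \<and> d' l = j}"
  proof (intro equalityI subsetI)
    fix l assume l: "l \<in> {l. l < r + s \<and> cat r d d' l = j}"
    then have "l = r + (l - r)" "l - r < s" if "\<not> l < r" using that by auto
    with l show "l \<in> {l. l < r \<and> d l = j} \<union> (+) r ` {l. l < s \<and> d' l = j}"
      by (cases "l < r") (auto simp: cat_def intro!: image_eqI[of _ _ "l - r"])
  qed (auto simp: cat_def)
  also have "card \<dots> = card {l. l < r \<and> d l = j} + card ((+) r ` {l. l < s \<and> d' l = j})"
    by (rule card_Un_disjoint) auto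
  finally show ?thesis by (simp add: card_image)
qed

text \<open>For a generator \<open>h\<close> of size at least 3 the sets \<open>h - {z}\<close> survive in every
  localisation, and the complete intersection property forces all other generators away from them.\<close>
lemma nci_exchange:
  assumes min: "minimal_sets G = G" and fin: "finite G" and finG: "\<And>g. g \<in> G \<Longrightarrow> finite g"
    and nci: "nearly_complete_intersection G"
    and h: "h \<in> G" "card h \<ge> 3" and g: "g \<in> G" "g \<noteq> h" and z: "z \<in> h"
  shows "\<exists>g'\<in>G - {h}. g' \<subseteq> insert z (g - h)"
proof -
  have anti: "A = B" if "A \<in> G" "B \<in> G" "A \<subseteq> B" for A B
    using min that unfolding minimal_sets_def by blast
  have CI: "complete_intersection (subst_one G z)"
    using nci h z unfolding nearly_complete_intersection_def by blast
  \<comment> \<open>Since \<open>z \<in> h\<close>, a set \<open>g' - {z}\<close> inside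
    \<open>h - {z}\<close> comes from some \<open>g' \<subseteq> h\<close>, and the generators form
    an antichain.\<close>
  have hz: "h - {z} \<in> subst_one G z"
    unfolding subst_one_def minimal_sets_def
  proof (intro CollectI conjI ballI impI)
    fix B assume "B \<in> (\<lambda>g. g - {z}) ` G" "B \<subseteq> h - {z}"
    then obtain g' where "g' \<in> G" "B = g' - {z}" "g' \<subseteq> h" using z by blast
    then show "B = h - {z}" using anti h by blast
  qed (use h in blast)
  have below: "\<exists>B\<in>subst_one G z. B \<subseteq> A - {z}" if "A \<in> G" for A
  proof -
    let ?S = "(\<lambda>g. g - {z}) ` {g \<in> G. g - {z} \<subseteq> A - {z}}"
    have "finite ?S" "?S \<noteq> {}" using fin that by auto
    from finite_has_minimal[OF this] obtain B where B: "B \<in> ?S" "\<forall>C\<in>?S. C \<subseteq> B \<longrightarrow> B = C"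
      by (rule bexE)
    have "B \<in> subst_one G z"
      unfolding subst_one_def minimal_sets_def
    proof (intro CollectI conjI ballI impI)
      show "B \<in> (\<lambda>g. g - {z}) ` G" using B(1) by blast
      fix C assume C: "C \<in> (\<lambda>g. g - {z}) ` G" "C \<subseteq> B"
      then have "C \<in> ?S" using B(1) by blast
      then show "C = B" using B(2) C(2) by blast
    qed
    with B(1) show ?thesis by blast
  qed
  have disj: "B = h - {z} \<or> B \<inter> h \<subseteq> {z}" if "B \<in> subst_one G z" for B
    using CI[unfolded complete_intersection_def, THEN bspec, OF that, THEN bspec, OF hz] by blast
  \<comment> \<open>Take a generator \<open>B\<close> of the localisation below \<open>A\<close>.
    Either it is \<open>h - {z}\<close>, which then lies in \<open>A\<close>, or it is disjoint from
    \<open>h\<close>; then the generator of \<open>G\<close> it comes from is the wanted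
    \<open>g'\<close>, which may contain \<open>z\<close> in addition.\<close>
  have key: "\<exists>g'\<in>G - {h}. g' \<subseteq> insert z (A - h) \<or> h - {z} \<subseteq> A" if A: "A \<in> G" "A \<noteq> h" for A
  proof -
    obtain B where B: "B \<in> subst_one G z" "B \<subseteq> A - {z}" using below[OF A(1)] by blast
    then obtain g' where g': "g' \<in> G" "B = g' - {z}" unfolding subst_one_def minimal_sets_def by blast
    show ?thesis
    proof (cases "B = h - {z}")
      case True
      then show ?thesis using B A by blast
    next
      case False
      then have "B \<inter> h \<subseteq> {z}" "g' \<noteq> h" using disj[OF B(1)] g' by auto
      then show ?thesis using B g' by blast
    qed
  qed
  show ?thesis
  proof (cases "h - {z} \<subseteq> g")
    case False
    then show ?thesis using key[OF g] by blast
  next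
    case True
    text \<open>Now \<open>g\<close> and \<open>h\<close> share two elements \<open>y\<close>, \<open>y'\<close>, and localising at \<open>y\<close> contradicts
      disjointness of \<open>g - {y}\<close> and \<open>h - {y}\<close>.\<close>
    have "finite h" using finG h by blast
    then have "\<not> card (h - {z}) \<le> Suc 0" "finite (h - {z})" using h z by simp_all
    then obtain y y' where y: "y \<in> h - {z}" "y' \<in> h - {z}" "y \<noteq> y'"
      unfolding card_le_Suc0_iff_eq[OF \<open>finite (h - {z})\<close>] by blast
    have CI: "complete_intersection (subst_one G y)"
      using nci h y unfolding nearly_complete_intersection_def by blast
    have minim: "A - {y} \<in> subst_one G y" if A: "A \<in> G" "y \<in> A" for A
      unfolding subst_one_def minimal_sets_def
    proof (intro CollectI conjI ballI impI)
      fix B assume "B \<in> (\<lambda>g. g - {y}) ` G" "B \<subseteq> A - {y}"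
      then obtain g' where "g' \<in> G" "B = g' - {y}" "g' \<subseteq> A" using A by blast
      then show "B = A - {y}" using anti A by blast
    qed (use A in blast)
    have "y \<in> g" "y' \<in> g" using True y by auto
    then have gy: "g - {y} \<in> subst_one G y" and hy: "h - {y} \<in> subst_one G y" and "y' \<in> (g - {y}) \<inter> (h - {y})"
      using minim g h y by auto
    then have "g - {y} = h - {y}"
      using CI[unfolded complete_intersection_def, THEN bspec, OF gy, THEN bspec, OF hy] by blast
    then have "g = h" using \<open>y \<in> g\<close> y by blast
    with g show ?thesis by blast
  qed
qed

theorem theorem4p3:
  fixes n :: nat and G :: "nat set set" and h :: "nat set"
  assumes "is_min_gen_set n G"
    and "nearly_complete_intersection G"
    and "h \<in> G" and "card h \<ge> 3"
  defines "I \<equiv> gen_ideal n (sqf_mono ` G :: ('k::field) mpoly set)"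
    and "H \<equiv> gen_ideal n {sqf_mono h :: 'k mpoly}"
    and "K \<equiv> gen_ideal n (sqf_mono ` (G - {h}) :: 'k mpoly set)"
  shows "\<forall>i j. i \<ge> 0 \<longrightarrow> j \<ge> 0 \<longrightarrow> betti n I i j = betti n H i j + betti n K i j + betti n (H \<inter> K) (i - 1) j"
proof -
  have G: "finite G" "\<And>g. g \<in> G \<Longrightarrow> g \<subseteq> {..<n}" "minimal_sets G = G"
    using assms(1) by (auto simp: is_min_gen_set_def)
  have finG: "finite g" if "g \<in> G" for g using G(2)[OF that] finite_subset by blast
  have h: "h \<in> G" "h \<subseteq> {..<n}" "finite h" using assms(3) G finG by auto
  obtain z where z: "z \<in> h" using assms(4) by fastforce
  \<comment> \<open>Generated by the monomials of the \<open>g\<close> divided by their common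
    factor with \<open>h\<close>.\<close>
  define J :: "'k mpoly set" where "J = mon_ideal n ((\<lambda>g. g - h) ` (G - {h}))"
  define x :: "'k mpoly" where "x = sqf_mono {z}"
  define u :: "'k mpoly" where "u = sqf_mono (h - {z})"
  have ux: "u * x = sqf_mono h"
    using sqf_mono_union[of "h - {z}" "{z}", where 'k = 'k] h z by (simp add: u_def x_def insert_absorb)
  have I: "I = mon_ideal n G" and K: "K = mon_ideal n (G - {h})" and H: "H = mon_ideal n {h}"
    unfolding I_def K_def H_def using G(2) h gen_ideal_eq_mon_ideal[of "{h}" n]
    by (auto intro!: gen_ideal_eq_mon_ideal)
  have J: "p \<in> J \<longleftrightarrow> p \<in> polyring n \<and> (u * x) * p \<in> K" for p
    unfolding ux K J_def sqf_mono_mult_mem_mon_ideal[OF h(2)]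
    by (simp add: mon_ideal_def Diff_subset_conv)
  have Hm: "H = {sqf_mono h * q | q. q \<in> polyring n}"
  proof (intro equalityI subsetI)
    fix p assume "p \<in> H"
    with h(2) obtain q where "q \<in> polyring n" "p = sqf_mono h * q"
      unfolding H by (rule sqf_mono_dvd_mon_ideal)
    then show "p \<in> {sqf_mono h * q | q. q \<in> polyring n}" by blast
  qed (auto simp: H sqf_mono_mult_mem_mon_ideal[OF h(2)])
  have HK: "H \<inter> K = (*) (sqf_mono h) ` J"
    unfolding Hm using J ux by auto
  have Isum: "I = {p + q * (u * x) | p q. p \<in> K \<and> q \<in> polyring n}"
  proof (intro equalityI subsetI)
    fix p assume p: "p \<in> I"
    have "insert h G = (G - {h}) \<union> {h}" by blast
    then have "p \<in> mon_ideal n ((G - {h}) \<union> {h})" using p h(1) by (simp add: I insert_absorb)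
    then obtain p1 p2 where "p1 \<in> mon_ideal n (G - {h})" and p2: "p2 \<in> mon_ideal n {h}" and p12: "p = p1 + p2"
      by (rule mon_ideal_UnE)
    obtain q where "q \<in> polyring n" "p2 = sqf_mono h * q"
      using h(2) p2 by (rule sqf_mono_dvd_mon_ideal)
    with p12 \<open>p1 \<in> _\<close> show "p \<in> {p + q * (u * x) | p q. p \<in> K \<and> q \<in> polyring n}"
      unfolding ux K by (auto simp: mult.commute)
  next
    fix p assume "p \<in> {p + q * (u * x) | p q. p \<in> K \<and> q \<in> polyring n}"
    then obtain p1 q where *: "p = p1 + q * (u * x)" "p1 \<in> K" "q \<in> polyring n" by blast
    then have "p1 \<in> I" by (auto simp: I K mon_ideal_def)
    moreover have "q * (u * x) \<in> I"
      unfolding ux I mult.commute[of q] using sqf_mono_mult_mem_mon_ideal[OF h(2), of q G] * h by auto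
    ultimately show "p \<in> I" unfolding *(1) I by (rule mon_ideal_add)
  qed
  have xJ: "x * p \<in> K" if p: "p \<in> J" for p
    unfolding x_def K
  proof (subst sqf_mono_mult_mem_mon_ideal, use h z in blast, intro conjI ballI)
    show "p \<in> polyring n" using p by (simp add: J)
    fix m assume "m \<in> Poly_Mapping.keys p"
    then obtain g where g: "g \<in> G" "g \<noteq> h" "g - h \<subseteq> Poly_Mapping.keys m"
      using p unfolding J_def mon_ideal_def by blast
    obtain g' where "g' \<in> G - {h}" "g' \<subseteq> insert z (g - h)"
      using nci_exchange[OF G(3,1) finG assms(2) h(1) assms(4) g(1,2) z] by blast
    with g(3) show "\<exists>g'\<in>G - {h}. g' \<subseteq> {z} \<union> Poly_Mapping.keys m" by blast
  qed
  \<comment> \<open>A constant term in \<open>J\<close> would need some \<open>g - h = {}\<close>,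
    that is, another generator inside \<open>h\<close>.\<close>
  have Jmin: "Poly_Mapping.lookup p 0 = 0" if p: "p \<in> J" for p
  proof (rule ccontr)
    assume "Poly_Mapping.lookup p 0 \<noteq> 0"
    then have "0 \<in> Poly_Mapping.keys p" by (simp add: in_keys_iff)
    then obtain g where "g \<in> G" "g \<noteq> h" "g \<subseteq> h"
      using p unfolding J_def mon_ideal_def by fastforce
    then show False using G(3) h(1) unfolding minimal_sets_def by blast
  qed
  have x: "x \<in> polyring n" "homogeneous x 1"
    unfolding x_def using polyring_sqf_mono[of "{z}" n] homogeneous_sqf_mono[of "{z}", where 'k = 'k] h z by auto
  \<comment> \<open>This makes \<open>u\<close> a non-unit, on which minimality of the cone
    rests.\<close>
  have "card (h - {z}) \<noteq> 0" using h z assms(4) by simp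
  then have "sqm (h - {z}) \<noteq> 0" using keys_sqm[of "h - {z}"] h by (metis card.empty finite_Diff keys_zero)
  then have u: "u \<in> polyring n" "homogeneous u (int (card h) - 1)" "Poly_Mapping.lookup u 0 = 0"
    unfolding u_def
    using polyring_sqf_mono[of "h - {z}" n] homogeneous_sqf_mono[of "h - {z}", where 'k = 'k] h z assms(4)
    by (auto simp: of_nat_diff sqf_mono_sqm lookup_single when_def)
  obtain RE DE CE where E: "resolves n K RE DE CE"
    unfolding K using mon_ideal_resolves by metis
  obtain RF DF CF where F: "resolves n J RF DF CF"
    unfolding J_def using mon_ideal_resolves by metis
  have RF0: "RF 0 = 1" "DF 0 = (\<lambda>_. 0)" using F by (auto simp: resolves_def)
  let ?DF = "\<lambda>i b. DF i b + int (card h)"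
  obtain C where C: "resolves n I (cone_rank RE RF) (cone_deg RE DE ?DF) C"
    using resolves_cone[OF E F x u xJ J Jmin] unfolding Isum by auto
  have hp: "sqf_mono h \<in> (polyring n :: 'k mpoly set)" "homogeneous (sqf_mono h :: 'k mpoly) (int (card h))"
    "sqf_mono h \<noteq> (0 :: 'k mpoly)"
    using polyring_sqf_mono homogeneous_sqf_mono h keys_sqf_mono_mult[OF h(3), of "1 :: 'k mpoly"] by auto
  have sub: "I \<subseteq> polyring n" "K \<subseteq> polyring n" "H \<subseteq> polyring n" "H \<inter> K \<subseteq> polyring n"
    unfolding I K H using mon_ideal_subset_polyring by blast+
  note bI = betti_eq[OF C sub(1)] and bK = betti_eq[OF E sub(2)]
    and bH = betti_eq[OF resolves_principal[OF hp, folded Hm] sub(3)]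
    and bHK = betti_eq[OF resolves_scale[OF F hp, folded HK] sub(4)]
  show ?thesis
  proof (intro allI impI)
    fix i j :: int assume "i \<ge> 0"
    then obtain k where k: "i = int k" by (metis nonneg_int_cases)
    \<comment> \<open>Position \<open>Suc k\<close> of the cone consists of position
      \<open>Suc k\<close> for \<open>K\<close> and position \<open>k\<close> for \<open>J\<close>,
      the latter twisted by the degree of \<open>h\<close>.\<close>
    have "betti n I i j = betti n K i j + card {l. l < RF k \<and> ?DF k l = j}"
      unfolding bI bK k by (simp add: cone_rank_def cone_deg_def card_cat)
    moreover have "card {l. l < RF k \<and> ?DF k l = j} = betti n H i j + betti n (H \<inter> K) (i - 1) j"
    \<comment> \<open>For \<open>k = 0\<close> the block is the twisted ring, which counts
      \<open>H\<close>, and \<open>betti\<close> is 0 at index -1. For \<open>k > 0\<close> the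
      resolution of \<open>H\<close> has rank 0, and position \<open>k\<close> for \<open>J\<close>
      gives index \<open>i - 1\<close> for \<open>H \<inter> K\<close>.\<close>
    proof (cases k)
      case 0
      then show ?thesis by (simp add: bH bHK k RF0)
    next
      case (Suc k')
      then have "nat (i - 1) = k'" "\<not> i - 1 < 0" by (auto simp: k)
      then show ?thesis unfolding bH bHK using Suc by (simp add: k)
    qed
    ultimately show "betti n I i j = betti n H i j + betti n K i j + betti n (H \<inter> K) (i - 1) j"
      by simp
  qed
qed

end
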